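(* For every finite partially ordered set $(\mathcal{A},\leq)$, one has \[(\mathcal{A},\leq)\sim_{\mathrm{M}}\mathcal{E}_{(\mathcal{A},\leq)},\] where $\mathcal{E}_{(\mathcal{A},\leq)}=(E,\mathcal{T})$ is the topological space with set of points $E=\mathcal{A}$ and topology $\mathcal{T}$ generated by the subsets $\downarrow e=\{x\in E : x\leq e\}$, $e\in E$. That is, the category of presheaves of sets on $(\mathcal{A},\leq)$ is equivalent to the topos $Sh(E,\mathcal{T})$ of sheaves of sets on $(E,\mathcal{T})$.
   Context: The topos of a topological space is its usual topos of sheaves of sets; the topos of a poset $(P,\leq)$ is the category of functors $(P,\leq)^{op}\to\mathbf{Set}$ (presheaves). $\sim_{\mathrm{M}}$ (Morita equivalence) means that the associated topoi are equivalent categories. *)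

theory Defs
  imports "HOL-Analysis.Analysis"
begin

section \<open>Categories, functors and equivalences\<close>

record ('o, 'm) cat =
  Ob :: "'o set"
  Ar :: "'m set"
  Dom :: "'m \<Rightarrow> 'o"
  Cod :: "'m \<Rightarrow> 'o"
  Ident :: "'o \<Rightarrow> 'm"
  Comp :: "'m \<Rightarrow> 'm \<Rightarrow> 'm"

text \<open>\<^term>\<open>Comp C g f\<close> is \<open>g\<close> after \<open>f\<close>, and is only meaningful when \<open>Cod C f = Dom C g\<close>.\<close>

locale category =
  fixes C :: "('o, 'm) cat"
  assumes Dom_Ob: "f \<in> Ar C \<Longrightarrow> Dom C f \<in> Ob C"
    and Cod_Ob: "f \<in> Ar C \<Longrightarrow> Cod C f \<in> Ob C"
    and Ident_Ar: "x \<in> Ob C \<Longrightarrow> Ident C x \<in> Ar C"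
    and Dom_Ident: "x \<in> Ob C \<Longrightarrow> Dom C (Ident C x) = x"
    and Cod_Ident: "x \<in> Ob C \<Longrightarrow> Cod C (Ident C x) = x"
    and Comp_Ar: "\<lbrakk>f \<in> Ar C; g \<in> Ar C; Cod C f = Dom C g\<rbrakk> \<Longrightarrow> Comp C g f \<in> Ar C"
    and Dom_Comp: "\<lbrakk>f \<in> Ar C; g \<in> Ar C; Cod C f = Dom C g\<rbrakk> \<Longrightarrow> Dom C (Comp C g f) = Dom C f"
    and Cod_Comp: "\<lbrakk>f \<in> Ar C; g \<in> Ar C; Cod C f = Dom C g\<rbrakk> \<Longrightarrow> Cod C (Comp C g f) = Cod C g"
    and Comp_Ident_right: "f \<in> Ar C \<Longrightarrow> Comp C f (Ident C (Dom C f)) = f"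
    and Comp_Ident_left: "f \<in> Ar C \<Longrightarrow> Comp C (Ident C (Cod C f)) f = f"
    and Comp_assoc:
      "\<lbrakk>f \<in> Ar C; g \<in> Ar C; h \<in> Ar C; Cod C f = Dom C g; Cod C g = Dom C h\<rbrakk>
        \<Longrightarrow> Comp C h (Comp C g f) = Comp C (Comp C h g) f"

definition is_iso :: "('o, 'm) cat \<Rightarrow> 'm \<Rightarrow> bool" where
  "is_iso C f \<longleftrightarrow> f \<in> Ar C \<and>
    (\<exists>g\<in>Ar C. Dom C g = Cod C f \<and> Cod C g = Dom C f \<and>
      Comp C g f = Ident C (Dom C f) \<and> Comp C f g = Ident C (Cod C f))"

definition op_cat :: "('o, 'm) cat \<Rightarrow> ('o, 'm) cat" where
  "op_cat C = \<lparr>Ob = Ob C, Ar = Ar C, Dom = Cod C, Cod = Dom C,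
    Ident = Ident C, Comp = (\<lambda>g f. Comp C f g)\<rparr>"

definition full_subcat :: "('o, 'm) cat \<Rightarrow> 'o set \<Rightarrow> ('o, 'm) cat" where
  "full_subcat C S = C\<lparr>Ob := Ob C \<inter> S, Ar := {f \<in> Ar C. Dom C f \<in> S \<and> Cod C f \<in> S}\<rparr>"

record ('o, 'm, 'p, 'n) cat_functor =
  on_ob :: "'o \<Rightarrow> 'p"
  on_ar :: "'m \<Rightarrow> 'n"

text \<open>Functors and natural transformations are required to be \<^const>\<open>undefined\<close> outside their
  domain (\<open>\<rightarrow>\<^sub>E\<close>, \<^const>\<open>extensional\<close>), so that HOL equality is equality of functors and of
  natural transformations.\<close>

definition is_functor ::
  "('o, 'm) cat \<Rightarrow> ('p, 'n) cat \<Rightarrow> ('o, 'm, 'p, 'n) cat_functor \<Rightarrow> bool" where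
  "is_functor C D F \<longleftrightarrow> category C \<and> category D \<and>
    on_ob F \<in> Ob C \<rightarrow>\<^sub>E Ob D \<and> on_ar F \<in> Ar C \<rightarrow>\<^sub>E Ar D \<and>
    (\<forall>f\<in>Ar C. Dom D (on_ar F f) = on_ob F (Dom C f) \<and> Cod D (on_ar F f) = on_ob F (Cod C f)) \<and>
    (\<forall>x\<in>Ob C. on_ar F (Ident C x) = Ident D (on_ob F x)) \<and>
    (\<forall>f\<in>Ar C. \<forall>g\<in>Ar C. Cod C f = Dom C g \<longrightarrow>
      on_ar F (Comp C g f) = Comp D (on_ar F g) (on_ar F f))"

definition id_functor :: "('o, 'm) cat \<Rightarrow> ('o, 'm, 'o, 'm) cat_functor" where
  "id_functor C = \<lparr>on_ob = (\<lambda>x\<in>Ob C. x), on_ar = (\<lambda>f\<in>Ar C. f)\<rparr>"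

definition comp_functor ::
  "('o, 'm) cat \<Rightarrow> ('p, 'n, 'q, 'k) cat_functor \<Rightarrow> ('o, 'm, 'p, 'n) cat_functor
    \<Rightarrow> ('o, 'm, 'q, 'k) cat_functor" where
  "comp_functor C G F =
    \<lparr>on_ob = (\<lambda>x\<in>Ob C. on_ob G (on_ob F x)), on_ar = (\<lambda>f\<in>Ar C. on_ar G (on_ar F f))\<rparr>"

definition nat_trans ::
  "('o, 'm) cat \<Rightarrow> ('p, 'n) cat \<Rightarrow> ('o, 'm, 'p, 'n) cat_functor \<Rightarrow> ('o, 'm, 'p, 'n) cat_functor
    \<Rightarrow> ('o \<Rightarrow> 'n) \<Rightarrow> bool" where
  "nat_trans C D F G \<eta> \<longleftrightarrow> is_functor C D F \<and> is_functor C D G \<and>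
    \<eta> \<in> Ob C \<rightarrow>\<^sub>E Ar D \<and>
    (\<forall>x\<in>Ob C. Dom D (\<eta> x) = on_ob F x \<and> Cod D (\<eta> x) = on_ob G x) \<and>
    (\<forall>f\<in>Ar C. Comp D (\<eta> (Cod C f)) (on_ar F f) = Comp D (on_ar G f) (\<eta> (Dom C f)))"

definition naturally_isomorphic ::
  "('o, 'm) cat \<Rightarrow> ('p, 'n) cat \<Rightarrow> ('o, 'm, 'p, 'n) cat_functor \<Rightarrow> ('o, 'm, 'p, 'n) cat_functor
    \<Rightarrow> bool" where
  "naturally_isomorphic C D F G \<longleftrightarrow> (\<exists>\<eta>. nat_trans C D F G \<eta> \<and> (\<forall>x\<in>Ob C. is_iso D (\<eta> x)))"

definition equivalent_categories :: "('o, 'm) cat \<Rightarrow> ('p, 'n) cat \<Rightarrow> bool" where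
  "equivalent_categories C D \<longleftrightarrow> (\<exists>F G. is_functor C D F \<and> is_functor D C G \<and>
    naturally_isomorphic C C (comp_functor C G F) (id_functor C) \<and>
    naturally_isomorphic D D (comp_functor D F G) (id_functor D))"

definition functor_cat ::
  "('o, 'm) cat \<Rightarrow> ('p, 'n) cat \<Rightarrow>
    (('o, 'm, 'p, 'n) cat_functor,
     ('o, 'm, 'p, 'n) cat_functor \<times> ('o \<Rightarrow> 'n) \<times> ('o, 'm, 'p, 'n) cat_functor) cat" where
  "functor_cat C D =
    \<lparr>Ob = {F. is_functor C D F},
     Ar = {(F, \<eta>, G). nat_trans C D F G \<eta>},
     Dom = (\<lambda>(F, \<eta>, G). F),
     Cod = (\<lambda>(F, \<eta>, G). G),
     Ident = (\<lambda>F. (F, \<lambda>x\<in>Ob C. Ident D (on_ob F x), F)),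
     Comp = (\<lambda>(G', \<theta>, H) (F, \<eta>, G). (F, \<lambda>x\<in>Ob C. Comp D (\<theta> x) (\<eta> x), H))\<rparr>"


section \<open>The category of sets\<close>

text \<open>HOL has no type of all sets. As in any foundation with universes, \<open>Set\<close> is the
  category of the members of a universe \<open>\<U>\<close> of small sets, here a collection of subsets of an
  arbitrary type. A Grothendieck universe satisfies the closure conditions below,
  and so does the collection of all subsets of any infinite type. They say that \<open>Set\<close>
  has finite products and subobjects; without them it is too small to contain the section
  sets of sheaves on a finite discrete space.\<close>

locale set_universe =
  fixes \<U> :: "'u set set"
  assumes ex_nonempty: "\<exists>X\<in>\<U>. X \<noteq> {}"
    and subset_closed: "\<lbrakk>X \<in> \<U>; Y \<subseteq> X\<rbrakk> \<Longrightarrow> Y \<in> \<U>"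
    and Times_closed: "\<lbrakk>X \<in> \<U>; Y \<in> \<U>\<rbrakk> \<Longrightarrow> \<exists>Z\<in>\<U>. Z \<approx> X \<times> Y"

definition set_cat :: "'u set set \<Rightarrow> ('u set, 'u set \<times> ('u \<Rightarrow> 'u) \<times> 'u set) cat" where
  "set_cat \<U> =
    \<lparr>Ob = \<U>,
     Ar = {(X, f, Y). X \<in> \<U> \<and> Y \<in> \<U> \<and> f \<in> X \<rightarrow>\<^sub>E Y},
     Dom = (\<lambda>(X, f, Y). X),
     Cod = (\<lambda>(X, f, Y). Y),
     Ident = (\<lambda>X. (X, \<lambda>x\<in>X. x, X)),
     Comp = (\<lambda>(Y', g, Z) (X, f, Y). (X, compose X g f, Z))\<rparr>"


section \<open>Posets, presheaves and sheaves\<close>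

text \<open>The pair \<open>(x, y)\<close> of the order relation is the unique arrow from \<open>x\<close> to \<open>y\<close>.\<close>

definition poset_cat :: "'a set \<Rightarrow> 'a rel \<Rightarrow> ('a, 'a \<times> 'a) cat" where
  "poset_cat A r =
    \<lparr>Ob = A, Ar = r, Dom = fst, Cod = snd, Ident = (\<lambda>x. (x, x)),
     Comp = (\<lambda>(y', z) (x, y). (x, z))\<rparr>"

type_synonym ('a, 'u) presheaf =
  "('a, 'a \<times> 'a, 'u set, 'u set \<times> ('u \<Rightarrow> 'u) \<times> 'u set) cat_functor"

definition poset_topos ::
  "'u set set \<Rightarrow> 'a set \<Rightarrow> 'a rel \<Rightarrow>
    (('a, 'u) presheaf, ('a, 'u) presheaf \<times> ('a \<Rightarrow> 'u set \<times> ('u \<Rightarrow> 'u) \<times> 'u set) \<times> ('a, 'u) presheaf) cat"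
  where "poset_topos \<U> A r = functor_cat (op_cat (poset_cat A r)) (set_cat \<U>)"

definition opens_rel :: "'a topology \<Rightarrow> 'a set rel" where
  "opens_rel T = {(V, U). openin T V \<and> openin T U \<and> V \<subseteq> U}"

text \<open>The restriction of \<open>s \<in> F(U)\<close> to \<open>V \<subseteq> U\<close>.\<close>

definition restr :: "('a, 'u) presheaf \<Rightarrow> 'a \<Rightarrow> 'a \<Rightarrow> 'u \<Rightarrow> 'u" where
  "restr F U V s = fst (snd (on_ar F (V, U))) s"

definition is_sheaf :: "'a topology \<Rightarrow> ('a set, 'u) presheaf \<Rightarrow> bool" where
  "is_sheaf T F \<longleftrightarrow>
    (\<forall>\<C> s. (\<forall>U\<in>\<C>. openin T U) \<and> (\<forall>U\<in>\<C>. s U \<in> on_ob F U) \<and>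
      (\<forall>U\<in>\<C>. \<forall>V\<in>\<C>. restr F U (U \<inter> V) (s U) = restr F V (U \<inter> V) (s V)) \<longrightarrow>
      (\<exists>!t. t \<in> on_ob F (\<Union>\<C>) \<and> (\<forall>U\<in>\<C>. restr F (\<Union>\<C>) U t = s U)))"

definition space_topos ::
  "'u set set \<Rightarrow> 'a topology \<Rightarrow>
    (('a set, 'u) presheaf,
     ('a set, 'u) presheaf \<times> ('a set \<Rightarrow> 'u set \<times> ('u \<Rightarrow> 'u) \<times> 'u set) \<times> ('a set, 'u) presheaf) cat"
  where "space_topos \<U> T =
    full_subcat (functor_cat (op_cat (poset_cat {U. openin T U} (opens_rel T))) (set_cat \<U>))
      {F. is_sheaf T F}"

definition down_set :: "'a set \<Rightarrow> 'a rel \<Rightarrow> 'a \<Rightarrow> 'a set" where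
  "down_set A r e = {x \<in> A. (x, e) \<in> r}"

definition poset_space :: "'a set \<Rightarrow> 'a rel \<Rightarrow> 'a topology" where
  "poset_space A r = topology_generated_by (down_set A r ` A)"


section \<open>Basic facts\<close>

lemma category_op_cat: "category C \<Longrightarrow> category (op_cat C)"
  unfolding category_def op_cat_def by simp

lemma category_full_subcat: "category C \<Longrightarrow> category (full_subcat C S)"
  unfolding category_def full_subcat_def by simp

lemma category_set_cat: "category (set_cat \<U>)"
  by unfold_locales
    (auto simp: set_cat_def compose_def PiE_iff extensional_def fun_eq_iff, metis+)

lemma category_poset_cat: "partial_order_on A r \<Longrightarrow> category (poset_cat A r)"
  by unfold_locales
    (auto simp: poset_cat_def partial_order_on_def preorder_on_def refl_on_def dest: transD)

lemma category_functor_cat: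
  assumes C: "category C" and D: "category D"
  shows "category (functor_cat C D)"
proof -
  interpret C: category C by (fact C)
  interpret D: category D by (fact D)
  have F_Ob: "on_ob F x \<in> Ob D" if "is_functor C D F" "x \<in> Ob C" for F x
    using that by (auto simp: is_functor_def)
  have F_Ar: "on_ar F f \<in> Ar D" "Dom D (on_ar F f) = on_ob F (Dom C f)"
    "Cod D (on_ar F f) = on_ob F (Cod C f)" if "is_functor C D F" "f \<in> Ar C" for F f
    using that by (auto simp: is_functor_def)
  have eta: "\<eta> x \<in> Ar D" "Dom D (\<eta> x) = on_ob F x" "Cod D (\<eta> x) = on_ob G x"
    if "nat_trans C D F G \<eta>" "x \<in> Ob C" for F G \<eta> x
    using that by (auto simp: nat_trans_def)
  have nat: "Comp D (\<eta> (Cod C f)) (on_ar F f) = Comp D (on_ar G f) (\<eta> (Dom C f))"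
    if "nat_trans C D F G \<eta>" "f \<in> Ar C" for F G \<eta> f
    using that by (auto simp: nat_trans_def)
  have func: "is_functor C D F" "is_functor C D G" if "nat_trans C D F G \<eta>" for F G \<eta>
    using that by (auto simp: nat_trans_def)
  have ext: "\<eta> \<in> extensional (Ob C)" if "nat_trans C D F G \<eta>" for F G \<eta>
    using that by (auto simp: nat_trans_def PiE_iff)
  have id_nt: "nat_trans C D F F (\<lambda>x\<in>Ob C. Ident D (on_ob F x))" if F: "is_functor C D F" for F
  proof -
    have "Comp D (Ident D (on_ob F (Cod C f))) (on_ar F f)
        = Comp D (on_ar F f) (Ident D (on_ob F (Dom C f)))" if f: "f \<in> Ar C" for f
      using D.Comp_Ident_left[OF F_Ar(1)[OF F f]] D.Comp_Ident_right[OF F_Ar(1)[OF F f]]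
        F_Ar(2,3)[OF F f] by simp
    then show ?thesis
      unfolding nat_trans_def
      by (auto simp: F F_Ob D.Ident_Ar D.Dom_Ident D.Cod_Ident C.Dom_Ob C.Cod_Ob)
  qed
  have comp_nt: "nat_trans C D F H (\<lambda>x\<in>Ob C. Comp D (\<theta> x) (\<eta> x))"
    if e: "nat_trans C D F G \<eta>" and t: "nat_trans C D G H \<theta>" for F G H \<eta> \<theta>
  proof -
    have "Comp D (Comp D (\<theta> (Cod C f)) (\<eta> (Cod C f))) (on_ar F f)
        = Comp D (on_ar H f) (Comp D (\<theta> (Dom C f)) (\<eta> (Dom C f)))" if f: "f \<in> Ar C" for f
    proof -
      note [simp] = f C.Dom_Ob C.Cod_Ob eta[OF e] eta[OF t] F_Ar[OF func(1)[OF e]]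
        F_Ar[OF func(2)[OF e]] F_Ar[OF func(2)[OF t]]
      have "Comp D (Comp D (\<theta> (Cod C f)) (\<eta> (Cod C f))) (on_ar F f)
          = Comp D (\<theta> (Cod C f)) (Comp D (\<eta> (Cod C f)) (on_ar F f))"
        by (simp add: D.Comp_assoc)
      also have "\<dots> = Comp D (Comp D (\<theta> (Cod C f)) (on_ar G f)) (\<eta> (Dom C f))"
        by (simp add: nat[OF e f] D.Comp_assoc)
      also have "\<dots> = Comp D (on_ar H f) (Comp D (\<theta> (Dom C f)) (\<eta> (Dom C f)))"
        by (simp add: nat[OF t f] D.Comp_assoc)
      finally show ?thesis .
    qed
    then show ?thesis
      unfolding nat_trans_def
      by (auto simp: func[OF e] func[OF t] eta[OF e] eta[OF t] D.Comp_Ar D.Dom_Comp D.Cod_Comp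
          C.Dom_Ob C.Cod_Ob)
  qed
  show ?thesis
  proof unfold_locales
    fix f assume "f \<in> Ar (functor_cat C D)"
    then obtain F \<eta> G where f: "f = (F, \<eta>, G)" and n: "nat_trans C D F G \<eta>"
      by (auto simp: functor_cat_def)
    show "Comp (functor_cat C D) f (Ident (functor_cat C D) (Dom (functor_cat C D) f)) = f"
      using ext[OF n] D.Comp_Ident_right[OF eta(1)[OF n]] eta(2)[OF n]
      by (auto simp: f functor_cat_def extensional_def fun_eq_iff)
    show "Comp (functor_cat C D) (Ident (functor_cat C D) (Cod (functor_cat C D) f)) f = f"
      using ext[OF n] D.Comp_Ident_left[OF eta(1)[OF n]] eta(3)[OF n]
      by (auto simp: f functor_cat_def extensional_def fun_eq_iff)
  qed (auto simp: functor_cat_def func id_nt comp_nt eta D.Comp_assoc intro!: restrict_ext)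
qed

lemma partial_order_on_opens_rel: "partial_order_on {U. openin T U} (opens_rel T)"
  by (auto simp: opens_rel_def partial_order_on_def preorder_on_def refl_on_def trans_def antisym_def)

lemma category_poset_topos: "partial_order_on A r \<Longrightarrow> category (poset_topos \<U> A r)"
  by (simp add: poset_topos_def category_functor_cat category_op_cat category_poset_cat
      category_set_cat)

lemma category_space_topos: "category (space_topos \<U> T)"
  by (simp add: space_topos_def category_full_subcat category_functor_cat category_op_cat
      category_poset_cat category_set_cat partial_order_on_opens_rel)

lemma topspace_poset_space: "partial_order_on A r \<Longrightarrow> topspace (poset_space A r) = A"
  by (auto simp: poset_space_def down_set_def topology_generated_by_topspace
      partial_order_on_def preorder_on_def refl_on_def)

lemma set_universe_UNIV:
  assumes "infinite (UNIV :: 'u set)"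
  shows "set_universe (UNIV :: 'u set set)"
proof
  fix X Y :: "'u set"
  have "(card_of (UNIV \<times> UNIV :: ('u \<times> 'u) set), card_of (UNIV :: 'u set)) \<in> ordIso"
    using assms by (rule card_of_Times_same_infinite)
  then obtain h :: "'u \<times> 'u \<Rightarrow> 'u" where "bij h"
    unfolding card_of_ordIso[symmetric] by (metis UNIV_Times_UNIV)
  then have "inj_on h (X \<times> Y)"
    by (meson bij_is_inj inj_on_subset subset_UNIV)
  then have "h ` (X \<times> Y) \<approx> X \<times> Y"
    by (rule inj_on_image_eqpoll_self)
  then show "\<exists>Z\<in>(UNIV :: 'u set set). Z \<approx> X \<times> Y"
    by blast
qed auto

end

theory Submission
  imports Defs
begin

text \<open>The sets \<open>\<down>x\<close> form a basis of the topology in which every open cover of \<open>\<down>x\<close> contains \<open>\<down>x\<close>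
  itself, since \<open>\<down>x\<close> is the least open set containing \<open>x\<close>. Hence the sheaf condition is vacuous on
  the basis, and restricting a sheaf along \<open>x \<mapsto> \<down>x\<close> is an equivalence. Full faithfulness is gluing
  along the cover of an open \<open>U\<close> by the sets \<open>\<down>x\<close>, \<open>x \<in> U\<close>. For essential surjectivity, a presheaf \<open>P\<close>
  is extended by \<open>U \<mapsto> lim\<^bsub>x \<in> U\<^esub> P(x)\<close>. Finiteness of the poset enters only here: the limit is a subset of
  a finite product, so the universe contains a copy of it.\<close>

section \<open>Fully faithful and essentially surjective functors\<close>

text \<open>No explicit inverse to restriction is ever made into a functor. The natural candidate
  sends \<open>P\<close> to its sets of compatible families over the open sets, but such families
  are functions on points and not even of the element type of the universe. They have to be copied
  into \<open>\<U>\<close> along arbitrary bijections, and a hand-built inverse would drag these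
  through its action on arrows and through two natural isomorphisms. Restriction, by contrast, is
  plain precomposition and involves no choice. With the criterion "fully faithful and essentially
  surjective" the bijections are confined to one presheaf at a time and to the level of objects;
  what the inverse does to arrows is settled once, for arbitrary categories.\<close>

definition hom_set :: "('o, 'm) cat \<Rightarrow> 'o \<Rightarrow> 'o \<Rightarrow> 'm set" where
  "hom_set C x y = {f \<in> Ar C. Dom C f = x \<and> Cod C f = y}"

definition fully_faithful ::
  "('o, 'm) cat \<Rightarrow> ('p, 'n) cat \<Rightarrow> ('o, 'm, 'p, 'n) cat_functor \<Rightarrow> bool" where
  "fully_faithful C D F \<longleftrightarrow> (\<forall>x\<in>Ob C. \<forall>y\<in>Ob C. \<forall>g\<in>hom_set D (on_ob F x) (on_ob F y).
    \<exists>!f. f \<in> hom_set C x y \<and> on_ar F f = g)"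

definition essentially_surjective ::
  "('o, 'm) cat \<Rightarrow> ('p, 'n) cat \<Rightarrow> ('o, 'm, 'p, 'n) cat_functor \<Rightarrow> bool" where
  "essentially_surjective C D F \<longleftrightarrow>
    (\<forall>y\<in>Ob D. \<exists>x\<in>Ob C. \<exists>e\<in>hom_set D (on_ob F x) y. is_iso D e)"

lemma equivalent_categories_sym:
  "equivalent_categories C D \<Longrightarrow> equivalent_categories D C"
  unfolding equivalent_categories_def by blast

lemma is_functor_id_functor: "category C \<Longrightarrow> is_functor C C (id_functor C)"
  by (auto simp: is_functor_def id_functor_def category_def)

lemma is_functor_comp_functor:
  assumes "is_functor C D F" "is_functor D E G"
  shows "is_functor C E (comp_functor C G F)"
proof -
  interpret category C using assms(1) by (simp add: is_functor_def)
  show ?thesis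
    using assms
    by (auto simp: is_functor_def comp_functor_def PiE_iff Dom_Ob Cod_Ob Ident_Ar Comp_Ar)
qed

lemma hom_set_comp:
  assumes "category C" "f \<in> hom_set C x y" "g \<in> hom_set C y z"
  shows "Comp C g f \<in> hom_set C x z"
  using assms by (auto simp: hom_set_def category_def)

lemma hom_set_Ident: "category C \<Longrightarrow> x \<in> Ob C \<Longrightarrow> Ident C x \<in> hom_set C x x"
  by (auto simp: hom_set_def category_def)

lemma hom_set_assoc:
  assumes "category C" "f \<in> hom_set C w x" "g \<in> hom_set C x y" "h \<in> hom_set C y z"
  shows "Comp C h (Comp C g f) = Comp C (Comp C h g) f"
  using assms category.Comp_assoc[OF assms(1), of f g h] by (auto simp: hom_set_def)

lemma hom_set_Ident_left:
  "category C \<Longrightarrow> f \<in> hom_set C x y \<Longrightarrow> Comp C (Ident C y) f = f"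
  by (auto simp: hom_set_def category.Comp_Ident_left)

lemma hom_set_Ident_right:
  "category C \<Longrightarrow> f \<in> hom_set C x y \<Longrightarrow> Comp C f (Ident C x) = f"
  by (auto simp: hom_set_def category.Comp_Ident_right)

lemma is_functor_hom_set:
  "is_functor C D F \<Longrightarrow> f \<in> hom_set C x y \<Longrightarrow> on_ar F f \<in> hom_set D (on_ob F x) (on_ob F y)"
  by (auto simp: is_functor_def hom_set_def)

lemma is_functor_Comp:
  "is_functor C D F \<Longrightarrow> f \<in> hom_set C x y \<Longrightarrow> g \<in> hom_set C y z \<Longrightarrow>
    on_ar F (Comp C g f) = Comp D (on_ar F g) (on_ar F f)"
  by (auto simp: is_functor_def hom_set_def)

lemma is_isoE:
  assumes "is_iso C e" "e \<in> hom_set C x y"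
  obtains i where "i \<in> hom_set C y x" "Comp C i e = Ident C x" "Comp C e i = Ident C y"
  using assms by (auto simp: is_iso_def hom_set_def)

lemma is_isoI:
  "e \<in> hom_set C x y \<Longrightarrow> i \<in> hom_set C y x \<Longrightarrow> Comp C i e = Ident C x \<Longrightarrow> Comp C e i = Ident C y
    \<Longrightarrow> is_iso C e"
  by (auto simp: is_iso_def hom_set_def)

lemma iso_cancel_left:
  assumes "category C" "is_iso C e" "e \<in> hom_set C y z"
    and "f \<in> hom_set C x y" "g \<in> hom_set C x y" "Comp C e f = Comp C e g"
  shows "f = g"
proof -
  obtain i where i: "i \<in> hom_set C z y" "Comp C i e = Ident C y"
    using assms(2,3) by (rule is_isoE)
  have "f = Comp C (Comp C i e) f" "g = Comp C (Comp C i e) g"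
    using assms i by (simp_all add: hom_set_Ident_left)
  then show ?thesis
    using hom_set_assoc[OF assms(1,4,3) i(1)] hom_set_assoc[OF assms(1,5,3) i(1)] assms(6)
    by metis
qed

lemma fully_faithful_inj:
  assumes "is_functor C D F" "fully_faithful C D F"
    and "f \<in> hom_set C x y" "g \<in> hom_set C x y" "on_ar F f = on_ar F g"
  shows "f = g"
proof -
  have "x \<in> Ob C" "y \<in> Ob C"
    using assms(1,3) by (auto simp: hom_set_def is_functor_def category_def)
  then show ?thesis
    using assms is_functor_hom_set[OF assms(1,3)] unfolding fully_faithful_def by metis
qed

text \<open>The inverse of \<open>on_ar F e\<close> lifts to \<open>C\<close> by fullness, and the
  two inverse laws for the lift hold because they hold after applying \<open>F\<close>, which is
  faithful.\<close>

lemma fully_faithful_reflects_iso: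
  assumes F: "is_functor C D F" and ff: "fully_faithful C D F"
    and e: "e \<in> hom_set C x y" and iso: "is_iso D (on_ar F e)"
  shows "is_iso C e"
proof -
  have C: "category C"
    using F by (simp add: is_functor_def)
  have ob: "x \<in> Ob C" "y \<in> Ob C"
    using C e by (auto simp: hom_set_def category_def)
  have F_Ident: "on_ar F (Ident C z) = Ident D (on_ob F z)" if "z \<in> Ob C" for z
    using F that by (simp add: is_functor_def)
  obtain i where i: "i \<in> hom_set D (on_ob F y) (on_ob F x)"
    "Comp D i (on_ar F e) = Ident D (on_ob F x)" "Comp D (on_ar F e) i = Ident D (on_ob F y)"
    using iso is_functor_hom_set[OF F e] by (rule is_isoE)
  obtain j where j: "j \<in> hom_set C y x" "on_ar F j = i"
    using ff ob i(1) unfolding fully_faithful_def by blast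
  show ?thesis
  proof (rule is_isoI[OF e j(1)])
    show "Comp C j e = Ident C x"
      by (rule fully_faithful_inj[OF F ff hom_set_comp[OF C e j(1)] hom_set_Ident[OF C ob(1)]])
        (simp add: is_functor_Comp[OF F e j(1)] j i F_Ident ob)
    show "Comp C e j = Ident C y"
      by (rule fully_faithful_inj[OF F ff hom_set_comp[OF C j(1) e] hom_set_Ident[OF C ob(2)]])
        (simp add: is_functor_Comp[OF F j(1) e] j i F_Ident ob)
  qed
qed

text \<open>The quasi-inverse picks for every \<open>y\<close> a preimage \<open>K y\<close> with an
  isomorphism \<open>\<epsilon> y\<close>. On arrows it is then forced: \<open>k g\<close> is the
  only arrow whose image under \<open>F\<close> makes the square with the
  \<open>\<epsilon>\<close>'s commute, and both functor laws follow from that uniqueness.\<close>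

theorem equivalent_categoriesI:
  assumes F: "is_functor C D F" and ff: "fully_faithful C D F"
    and es: "essentially_surjective C D F"
  shows "equivalent_categories C D"
proof -
  have C: "category C" and D: "category D"
    using F by (auto simp: is_functor_def)
  have F_Ob: "on_ob F x \<in> Ob D" if "x \<in> Ob C" for x
    using F that by (auto simp: is_functor_def)
  have F_Ident: "on_ar F (Ident C z) = Ident D (on_ob F z)" if "z \<in> Ob C" for z
    using F that by (simp add: is_functor_def)
  have homC: "f \<in> hom_set C (Dom C f) (Cod C f)" "Dom C f \<in> Ob C" "Cod C f \<in> Ob C"
    if "f \<in> Ar C" for f
    using C that by (auto simp: hom_set_def category_def)
  have homD: "f \<in> hom_set D (Dom D f) (Cod D f)" "Dom D f \<in> Ob D" "Cod D f \<in> Ob D"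
    if "f \<in> Ar D" for f
    using D that by (auto simp: hom_set_def category_def)
  obtain K \<epsilon> where K: "\<And>y. y \<in> Ob D \<Longrightarrow> K y \<in> Ob C"
    and \<epsilon>: "\<And>y. y \<in> Ob D \<Longrightarrow> \<epsilon> y \<in> hom_set D (on_ob F (K y)) y"
    and iso: "\<And>y. y \<in> Ob D \<Longrightarrow> is_iso D (\<epsilon> y)"
    using es unfolding essentially_surjective_def by metis
  \<comment> \<open>The arrow \<open>h\<close> is the lift along \<open>F\<close> of
    \<open>g\<close> conjugated by the isomorphisms \<open>\<epsilon>\<close>.\<close>
  have "\<exists>h. h \<in> hom_set C (K (Dom D g)) (K (Cod D g)) \<and>
      Comp D (\<epsilon> (Cod D g)) (on_ar F h) = Comp D g (\<epsilon> (Dom D g))" if g: "g \<in> Ar D" for g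
  proof -
    note g' = homD[OF g]
    obtain i where i: "i \<in> hom_set D (Cod D g) (on_ob F (K (Cod D g)))"
      "Comp D (\<epsilon> (Cod D g)) i = Ident D (Cod D g)"
      using iso[OF g'(3)] \<epsilon>[OF g'(3)] by (rule is_isoE)
    have ge: "Comp D g (\<epsilon> (Dom D g)) \<in> hom_set D (on_ob F (K (Dom D g))) (Cod D g)"
      using D \<epsilon>[OF g'(2)] g'(1) by (rule hom_set_comp)
    obtain h where h: "h \<in> hom_set C (K (Dom D g)) (K (Cod D g))"
      "on_ar F h = Comp D i (Comp D g (\<epsilon> (Dom D g)))"
      using ff K[OF g'(2)] K[OF g'(3)] hom_set_comp[OF D ge i(1)]
      unfolding fully_faithful_def by blast
    then show ?thesis
      using hom_set_assoc[OF D ge i(1) \<epsilon>[OF g'(3)]] hom_set_Ident_left[OF D ge] i(2) by auto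
  qed
  then obtain k where k: "\<And>g. g \<in> Ar D \<Longrightarrow> k g \<in> hom_set C (K (Dom D g)) (K (Cod D g))"
    and k_nat: "\<And>g. g \<in> Ar D \<Longrightarrow>
      Comp D (\<epsilon> (Cod D g)) (on_ar F (k g)) = Comp D g (\<epsilon> (Dom D g))"
    by metis
  have k_hom: "k g \<in> hom_set C (K y) (K z)" "Comp D (\<epsilon> z) (on_ar F (k g)) = Comp D g (\<epsilon> y)"
    if "g \<in> hom_set D y z" for g y z
    using that k[of g] k_nat[of g] by (auto simp: hom_set_def)
  \<comment> \<open>Uniqueness of \<open>k g\<close>: the isomorphism \<open>\<epsilon> z\<close>
    cancels on the left, and then \<open>F\<close> is faithful. Each functor law thereby reduces to
    checking one square in \<open>D\<close>.\<close>
  have k_eq: "k g = h" if g: "g \<in> hom_set D y z" and h: "h \<in> hom_set C (K y) (K z)"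
    and eq: "Comp D (\<epsilon> z) (on_ar F h) = Comp D g (\<epsilon> y)" for g h y z
  proof -
    have z: "z \<in> Ob D"
      using D g by (auto simp: hom_set_def category_def)
    have "on_ar F (k g) = on_ar F h"
      by (rule iso_cancel_left[OF D iso[OF z] \<epsilon>[OF z]
            is_functor_hom_set[OF F k_hom(1)[OF g]] is_functor_hom_set[OF F h]])
        (simp add: k_hom(2)[OF g] eq)
    then show ?thesis
      by (rule fully_faithful_inj[OF F ff k_hom(1)[OF g] h])
  qed
  define G where "G = \<lparr>on_ob = (\<lambda>y\<in>Ob D. K y), on_ar = (\<lambda>g\<in>Ar D. k g)\<rparr>"
  have G_Ident: "k (Ident D y) = Ident C (K y)" if y: "y \<in> Ob D" for y
    by (rule k_eq[OF hom_set_Ident[OF D y] hom_set_Ident[OF C K[OF y]]])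
      (simp add: F_Ident K y hom_set_Ident_left[OF D \<epsilon>] hom_set_Ident_right[OF D \<epsilon>])
  have G_Comp: "k (Comp D g f) = Comp C (k g) (k f)"
    if f: "f \<in> hom_set D x y" and g: "g \<in> hom_set D y z" for f g x y z
  proof (rule k_eq[OF hom_set_comp[OF D f g] hom_set_comp[OF C k_hom(1)[OF f] k_hom(1)[OF g]]])
    have ob: "x \<in> Ob D" "y \<in> Ob D" "z \<in> Ob D"
      using D f g by (auto simp: hom_set_def category_def)
    have "Comp D (\<epsilon> z) (on_ar F (Comp C (k g) (k f)))
        = Comp D (Comp D g (\<epsilon> y)) (on_ar F (k f))"
      using hom_set_assoc[OF D is_functor_hom_set[OF F k_hom(1)[OF f]]
          is_functor_hom_set[OF F k_hom(1)[OF g]] \<epsilon>[OF ob(3)]]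
      by (simp add: is_functor_Comp[OF F k_hom(1)[OF f] k_hom(1)[OF g]] k_hom(2)[OF g])
    also have "\<dots> = Comp D g (Comp D f (\<epsilon> x))"
      using hom_set_assoc[OF D is_functor_hom_set[OF F k_hom(1)[OF f]] \<epsilon>[OF ob(2)] g]
      by (simp add: k_hom(2)[OF f])
    finally show "Comp D (\<epsilon> z) (on_ar F (Comp C (k g) (k f))) = Comp D (Comp D g f) (\<epsilon> x)"
      using hom_set_assoc[OF D \<epsilon>[OF ob(1)] f g] by simp
  qed
  have G: "is_functor D C G"
    unfolding is_functor_def
  proof (intro conjI ballI impI)
    fix f g assume fg: "f \<in> Ar D" "g \<in> Ar D" "Cod D f = Dom D g"
    then have "f \<in> hom_set D (Dom D f) (Dom D g)"
      by (simp add: hom_set_def)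
    with fg show "on_ar G (Comp D g f) = Comp C (on_ar G g) (on_ar G f)"
      using D by (simp add: G_def category.Comp_Ar G_Comp[OF _ homD(1)])
  qed (use C D k K G_Ident homD in \<open>auto simp: G_def hom_set_def category.Ident_Ar\<close>)
  have "naturally_isomorphic D D (comp_functor D F G) (id_functor D)"
    unfolding naturally_isomorphic_def
  proof (intro exI conjI ballI)
    show "nat_trans D D (comp_functor D F G) (id_functor D) (\<lambda>y\<in>Ob D. \<epsilon> y)"
      unfolding nat_trans_def
      using is_functor_comp_functor[OF G F] is_functor_id_functor[OF D] \<epsilon> k_nat homD
      by (auto simp: comp_functor_def id_functor_def G_def hom_set_def)
  qed (simp add: iso)
  moreover have "naturally_isomorphic C C (comp_functor C G F) (id_functor C)"
  proof -
    \<comment> \<open>The component at \<open>x\<close> is the lift of \<open>\<epsilon>\<close> at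
      \<open>on_ob F x\<close>, so its naturality can be tested after applying \<open>F\<close>,
      where it is the defining square of \<open>k\<close>.\<close>
    have "\<exists>f. f \<in> hom_set C (K (on_ob F x)) x \<and> on_ar F f = \<epsilon> (on_ob F x)" if x: "x \<in> Ob C" for x
      using ff K[OF F_Ob[OF x]] x \<epsilon>[OF F_Ob[OF x]] unfolding fully_faithful_def by blast
    then obtain \<eta> where \<eta>: "\<And>x. x \<in> Ob C \<Longrightarrow> \<eta> x \<in> hom_set C (K (on_ob F x)) x"
      and F_\<eta>: "\<And>x. x \<in> Ob C \<Longrightarrow> on_ar F (\<eta> x) = \<epsilon> (on_ob F x)"
      by metis
    have iso_\<eta>: "is_iso C (\<eta> x)" if "x \<in> Ob C" for x
      by (rule fully_faithful_reflects_iso[OF F ff \<eta>[OF that]])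
        (simp add: F_\<eta> that iso F_Ob)
    have nat_\<eta>: "Comp C (\<eta> (Cod C f)) (k (on_ar F f)) = Comp C f (\<eta> (Dom C f))"
      if "f \<in> Ar C" for f
    proof -
      note f = homC[OF that]
      note Ff = is_functor_hom_set[OF F f(1)]
      show ?thesis
        by (rule fully_faithful_inj[OF F ff hom_set_comp[OF C k_hom(1)[OF Ff] \<eta>[OF f(3)]]
              hom_set_comp[OF C \<eta>[OF f(2)] f(1)]])
          (simp add: is_functor_Comp[OF F k_hom(1)[OF Ff] \<eta>[OF f(3)]]
            is_functor_Comp[OF F \<eta>[OF f(2)] f(1)] F_\<eta> f k_hom(2)[OF Ff])
    qed
    show ?thesis
      unfolding naturally_isomorphic_def
    proof (intro exI conjI ballI)
      show "nat_trans C C (comp_functor C G F) (id_functor C) (\<lambda>x\<in>Ob C. \<eta> x)"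
        unfolding nat_trans_def
        using is_functor_comp_functor[OF F G] is_functor_id_functor[OF C] \<eta> nat_\<eta> homC F_Ob
          is_functor_hom_set[OF F homC(1)]
        by (auto simp: comp_functor_def id_functor_def G_def hom_set_def)
    qed (simp add: iso_\<eta>)
  qed
  ultimately show ?thesis
    unfolding equivalent_categories_def using F G by blast
qed

section \<open>Inclusions, precomposition and pointwise isomorphisms\<close>

text \<open>The arrows of a full subcategory are literally arrows of \<open>C\<close>, so its
  identity functor, read with target \<open>C\<close>, is the inclusion.\<close>

lemma is_functor_full_subcat_inclusion:
  assumes "category C"
  shows "is_functor (full_subcat C S) C (id_functor (full_subcat C S))"
  using assms category_full_subcat[OF assms, of S]
  by (auto simp: is_functor_def id_functor_def full_subcat_def category_def)

definition precomp_functor ::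
  "('b, 'c) cat \<Rightarrow> ('o, 'm) cat \<Rightarrow> ('p, 'n) cat \<Rightarrow> ('b, 'c, 'o, 'm) cat_functor \<Rightarrow>
    (('o, 'm, 'p, 'n) cat_functor,
     ('o, 'm, 'p, 'n) cat_functor \<times> ('o \<Rightarrow> 'n) \<times> ('o, 'm, 'p, 'n) cat_functor,
     ('b, 'c, 'p, 'n) cat_functor,
     ('b, 'c, 'p, 'n) cat_functor \<times> ('b \<Rightarrow> 'n) \<times> ('b, 'c, 'p, 'n) cat_functor) cat_functor" where
  "precomp_functor B C D H =
    \<lparr>on_ob = (\<lambda>F\<in>Ob (functor_cat C D). comp_functor B F H),
     on_ar = (\<lambda>(F, \<eta>, G)\<in>Ar (functor_cat C D).
       (comp_functor B F H, \<lambda>x\<in>Ob B. \<eta> (on_ob H x), comp_functor B G H))\<rparr>"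

lemma nat_trans_precomp:
  assumes H: "is_functor B C H" and \<eta>: "nat_trans C D F G \<eta>"
  shows "nat_trans B D (comp_functor B F H) (comp_functor B G H) (\<lambda>x\<in>Ob B. \<eta> (on_ob H x))"
proof -
  interpret category B using H by (simp add: is_functor_def)
  have *: "is_functor B D (comp_functor B F H)" "is_functor B D (comp_functor B G H)"
    using H \<eta> by (auto simp: nat_trans_def intro: is_functor_comp_functor)
  have H_Ob: "on_ob H x \<in> Ob C" if "x \<in> Ob B" for x
    using H that by (auto simp: is_functor_def)
  have H_Ar: "on_ar H f \<in> Ar C" "on_ob H (Dom B f) = Dom C (on_ar H f)"
    "on_ob H (Cod B f) = Cod C (on_ar H f)" if "f \<in> Ar B" for f
    using H that by (auto simp: is_functor_def)
  show ?thesis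
    using \<eta> * unfolding nat_trans_def
    by (auto simp: comp_functor_def H_Ob H_Ar Dom_Ob Cod_Ob PiE_iff)
qed

lemma is_functor_precomp_functor:
  assumes H: "is_functor B C H" and D: "category D"
  shows "is_functor (functor_cat C D) (functor_cat B D) (precomp_functor B C D H)"
proof -
  have B: "category B" and C: "category C"
    using H by (auto simp: is_functor_def)
  have H_Ob: "on_ob H x \<in> Ob C" if "x \<in> Ob B" for x
    using H that by (auto simp: is_functor_def)
  let ?C = "functor_cat C D" and ?B = "functor_cat B D" and ?P = "precomp_functor B C D H"
  have cat: "category ?C" "category ?B"
    using B C D by (auto intro: category_functor_cat)
  show ?thesis
    unfolding is_functor_def[of ?C]
  proof (intro conjI ballI impI cat)
    show "on_ob ?P \<in> Ob ?C \<rightarrow>\<^sub>E Ob ?B" "on_ar ?P \<in> Ar ?C \<rightarrow>\<^sub>E Ar ?B"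
      using is_functor_comp_functor[OF H] nat_trans_precomp[OF H]
      by (auto simp: precomp_functor_def functor_cat_def)
  next
    fix f assume "f \<in> Ar ?C"
    then show "Dom ?B (on_ar ?P f) = on_ob ?P (Dom ?C f)" "Cod ?B (on_ar ?P f) = on_ob ?P (Cod ?C f)"
      by (auto simp: precomp_functor_def functor_cat_def nat_trans_def)
  next
    fix F assume F: "F \<in> Ob ?C"
    \<comment> \<open>\<open>on_ar ?P\<close> is undefined off \<open>Ar ?C\<close>, so it unfolds
      only once the identity is known to be an arrow; the same holds for the composite
      below.\<close>
    then show "on_ar ?P (Ident ?C F) = Ident ?B (on_ob ?P F)"
      using category.Ident_Ar[OF cat(1) F]
      by (auto simp: precomp_functor_def functor_cat_def comp_functor_def H_Ob intro!: restrict_ext)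
  next
    fix f g assume fg: "f \<in> Ar ?C" "g \<in> Ar ?C" "Cod ?C f = Dom ?C g"
    obtain F \<eta> G \<theta> K where "f = (F, \<eta>, G)" "g = (G, \<theta>, K)"
      using fg by (auto simp: functor_cat_def)
    then show "on_ar ?P (Comp ?C g f) = Comp ?B (on_ar ?P g) (on_ar ?P f)"
      using fg category.Comp_Ar[OF cat(1) fg]
      by (auto simp: precomp_functor_def functor_cat_def H_Ob intro!: restrict_ext)
  qed
qed

text \<open>Pointwise inverses are automatically natural: both sides of their naturality square
  become \<open>on_ar G f\<close> after composition with the isomorphism
  \<open>\<eta> (Cod C f)\<close>, which can be cancelled.\<close>

lemma is_iso_functor_cat:
  assumes \<eta>: "nat_trans C D F G \<eta>" and iso: "\<And>x. x \<in> Ob C \<Longrightarrow> is_iso D (\<eta> x)"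
  shows "is_iso (functor_cat C D) (F, \<eta>, G)"
proof -
  have F: "is_functor C D F" and G: "is_functor C D G" and C: "category C" and D: "category D"
    using \<eta> by (auto simp: nat_trans_def is_functor_def)
  have \<eta>_hom: "\<eta> x \<in> hom_set D (on_ob F x) (on_ob G x)" if "x \<in> Ob C" for x
    using \<eta> that by (auto simp: nat_trans_def hom_set_def)
  have "\<exists>i. i \<in> hom_set D (on_ob G x) (on_ob F x) \<and>
      Comp D i (\<eta> x) = Ident D (on_ob F x) \<and> Comp D (\<eta> x) i = Ident D (on_ob G x)"
    if "x \<in> Ob C" for x
    by (rule is_isoE[OF iso[OF that] \<eta>_hom[OF that]]) blast
  then obtain \<iota> where \<iota>: "\<And>x. x \<in> Ob C \<Longrightarrow> \<iota> x \<in> hom_set D (on_ob G x) (on_ob F x)"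
    "\<And>x. x \<in> Ob C \<Longrightarrow> Comp D (\<iota> x) (\<eta> x) = Ident D (on_ob F x)"
    "\<And>x. x \<in> Ob C \<Longrightarrow> Comp D (\<eta> x) (\<iota> x) = Ident D (on_ob G x)"
    by metis
  have nat: "Comp D (\<iota> (Cod C f)) (on_ar G f) = Comp D (on_ar F f) (\<iota> (Dom C f))"
    if f: "f \<in> Ar C" for f
  proof -
    have ob: "Dom C f \<in> Ob C" "Cod C f \<in> Ob C" and "f \<in> hom_set C (Dom C f) (Cod C f)"
      using C f by (auto simp: category_def hom_set_def)
    note Ff = is_functor_hom_set[OF F this(3)] and Gf = is_functor_hom_set[OF G this(3)]
    note \<iota>1 = \<iota>(1)[OF ob(1)] and \<iota>2 = \<iota>(1)[OF ob(2)]
    have "Comp D (\<eta> (Cod C f)) (Comp D (on_ar F f) (\<iota> (Dom C f)))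
        = Comp D (on_ar G f) (Comp D (\<eta> (Dom C f)) (\<iota> (Dom C f)))"
      using \<eta> f hom_set_assoc[OF D \<iota>1 Ff \<eta>_hom[OF ob(2)]]
        hom_set_assoc[OF D \<iota>1 \<eta>_hom[OF ob(1)] Gf] by (simp add: nat_trans_def)
    also have "\<dots> = on_ar G f"
      using hom_set_Ident_right[OF D Gf] by (simp add: \<iota> ob)
    also have "\<dots> = Comp D (\<eta> (Cod C f)) (Comp D (\<iota> (Cod C f)) (on_ar G f))"
      using hom_set_assoc[OF D Gf \<iota>2 \<eta>_hom[OF ob(2)]] hom_set_Ident_left[OF D Gf]
      by (simp add: \<iota> ob)
    finally show ?thesis
      using iso_cancel_left[OF D iso[OF ob(2)] \<eta>_hom[OF ob(2)] hom_set_comp[OF D \<iota>1 Ff]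
          hom_set_comp[OF D Gf \<iota>2]] by simp
  qed
  have "nat_trans C D G F (\<lambda>x\<in>Ob C. \<iota> x)"
    using F G \<iota>(1) nat C unfolding nat_trans_def
    by (auto simp: hom_set_def category.Dom_Ob category.Cod_Ob)
  then have "(G, \<lambda>x\<in>Ob C. \<iota> x, F) \<in> hom_set (functor_cat C D) G F"
    "(F, \<eta>, G) \<in> hom_set (functor_cat C D) F G"
    using \<eta> by (auto simp: hom_set_def functor_cat_def)
  then show ?thesis
    by (intro is_isoI[of "(F, \<eta>, G)" _ F G "(G, \<lambda>x\<in>Ob C. \<iota> x, F)"])
      (simp_all add: functor_cat_def \<iota> cong: restrict_cong)
qed

lemma is_iso_set_cat:
  assumes "X \<in> \<U>" "Y \<in> \<U>" "f \<in> X \<rightarrow>\<^sub>E Y" "bij_betw f X Y"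
  shows "is_iso (set_cat \<U>) (X, f, Y)"
proof (rule is_isoI)
  let ?i = "restrict (inv_into X f) Y"
  have i: "?i \<in> Y \<rightarrow>\<^sub>E X"
    using assms(4) by (auto simp: bij_betw_def inv_into_into)
  then show "(Y, ?i, X) \<in> hom_set (set_cat \<U>) Y X" "(X, f, Y) \<in> hom_set (set_cat \<U>) X Y"
    using assms by (auto simp: hom_set_def set_cat_def)
  show "Comp (set_cat \<U>) (Y, ?i, X) (X, f, Y) = Ident (set_cat \<U>) X"
    using assms by (auto simp: set_cat_def compose_def bij_betw_def intro!: restrict_ext)
  show "Comp (set_cat \<U>) (X, f, Y) (Y, ?i, X) = Ident (set_cat \<U>) Y"
    using assms by (auto simp: set_cat_def compose_def bij_betw_def f_inv_into_f intro!: restrict_ext)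
qed

section \<open>Presheaves on a poset\<close>

abbreviation is_presheaf :: "'u set set \<Rightarrow> 'a set \<Rightarrow> 'a rel \<Rightarrow> ('a, 'u) presheaf \<Rightarrow> bool" where
  "is_presheaf \<U> A r \<equiv> is_functor (op_cat (poset_cat A r)) (set_cat \<U>)"

abbreviation presheaf_hom :: "'u set set \<Rightarrow> 'a set \<Rightarrow> 'a rel \<Rightarrow> ('a, 'u) presheaf \<Rightarrow>
    ('a, 'u) presheaf \<Rightarrow> ('a \<Rightarrow> 'u set \<times> ('u \<Rightarrow> 'u) \<times> 'u set) \<Rightarrow> bool" where
  "presheaf_hom \<U> A r \<equiv> nat_trans (op_cat (poset_cat A r)) (set_cat \<U>)"

definition component :: "('a \<Rightarrow> 'u set \<times> ('u \<Rightarrow> 'u) \<times> 'u set) \<Rightarrow> 'a \<Rightarrow> 'u \<Rightarrow> 'u" where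
  "component \<eta> x = fst (snd (\<eta> x))"

lemma partial_order_on_mem: "partial_order_on A r \<Longrightarrow> (x, y) \<in> r \<Longrightarrow> x \<in> A \<and> y \<in> A"
  by (auto simp: partial_order_on_def preorder_on_def)

lemma partial_order_on_refl: "partial_order_on A r \<Longrightarrow> x \<in> A \<Longrightarrow> (x, x) \<in> r"
  by (auto simp: partial_order_on_def preorder_on_def refl_on_def)

lemma partial_order_on_trans:
  "partial_order_on A r \<Longrightarrow> (x, y) \<in> r \<Longrightarrow> (y, z) \<in> r \<Longrightarrow> (x, z) \<in> r"
  by (auto simp: partial_order_on_def preorder_on_def dest: transD)

lemma set_cat_arrow_eq:
  "f \<in> Ar (set_cat \<U>) \<Longrightarrow> f = (Dom (set_cat \<U>) f, fst (snd f), Cod (set_cat \<U>) f) \<and>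
    fst (snd f) \<in> Dom (set_cat \<U>) f \<rightarrow>\<^sub>E Cod (set_cat \<U>) f"
  by (auto simp: set_cat_def)

text \<open>The elementwise form of a contravariant functor on a poset. From here on presheaves are
  handled through sections and \<open>restr\<close>. Passing to \<open>op_cat\<close> is what makes
  the pair \<open>(x, y)\<close>, with \<open>x\<close> below \<open>y\<close>, act from
  \<open>on_ob F y\<close> to \<open>on_ob F x\<close>.\<close>

lemma
  assumes "is_presheaf \<U> A r F" "partial_order_on A r"
  shows presheaf_ob: "x \<in> A \<Longrightarrow> on_ob F x \<in> \<U>"
    and presheaf_ar: "(x, y) \<in> r \<Longrightarrow> on_ar F (x, y) = (on_ob F y, restr F y x, on_ob F x)"
    and restr_mem: "(x, y) \<in> r \<Longrightarrow> s \<in> on_ob F y \<Longrightarrow> restr F y x s \<in> on_ob F x"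
    and restr_id: "x \<in> A \<Longrightarrow> s \<in> on_ob F x \<Longrightarrow> restr F x x s = s"
    and restr_restr: "(x, y) \<in> r \<Longrightarrow> (y, z) \<in> r \<Longrightarrow> s \<in> on_ob F z \<Longrightarrow>
      restr F y x (restr F z y s) = restr F z x s"
proof -
  show "x \<in> A \<Longrightarrow> on_ob F x \<in> \<U>"
    using assms(1) by (auto simp: is_functor_def op_cat_def poset_cat_def set_cat_def)
  have ar: "on_ar F (x, y) = (on_ob F y, restr F y x, on_ob F x) \<and>
      restr F y x \<in> on_ob F y \<rightarrow>\<^sub>E on_ob F x"
    if "(x, y) \<in> r" for x y
  proof -
    have "on_ar F (x, y) \<in> Ar (set_cat \<U>)" "Dom (set_cat \<U>) (on_ar F (x, y)) = on_ob F y"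
      "Cod (set_cat \<U>) (on_ar F (x, y)) = on_ob F x"
      using is_functor_hom_set[OF assms(1), of "(x, y)" y x] that
      by (simp_all add: hom_set_def op_cat_def poset_cat_def)
    then show ?thesis
      using set_cat_arrow_eq[of "on_ar F (x, y)" \<U>] by (simp add: restr_def[abs_def])
  qed
  show "(x, y) \<in> r \<Longrightarrow> on_ar F (x, y) = (on_ob F y, restr F y x, on_ob F x)"
    using ar[of x y] by blast
  show "(x, y) \<in> r \<Longrightarrow> s \<in> on_ob F y \<Longrightarrow> restr F y x s \<in> on_ob F x"
    using ar[of x y] by (blast dest: PiE_mem)
  show "restr F x x s = s" if "x \<in> A" "s \<in> on_ob F x"
  proof -
    have "on_ar F (x, x) = Ident (set_cat \<U>) (on_ob F x)"
      using assms(1) that by (simp add: is_functor_def op_cat_def poset_cat_def)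
    then show ?thesis
      using that by (simp add: restr_def set_cat_def)
  qed
  show "restr F y x (restr F z y s) = restr F z x s"
    if "(x, y) \<in> r" "(y, z) \<in> r" "s \<in> on_ob F z"
  proof -
    have "on_ar F (x, z) = Comp (set_cat \<U>) (on_ar F (x, y)) (on_ar F (y, z))"
      using is_functor_Comp[OF assms(1), of "(y, z)" z y "(x, y)" x] that
      by (simp add: hom_set_def op_cat_def poset_cat_def)
    then have "on_ar F (x, z) = (on_ob F z, compose (on_ob F z) (restr F y x) (restr F z y), on_ob F x)"
      using ar[OF that(1)] ar[OF that(2)] by (simp add: set_cat_def)
    then show ?thesis
      using that(3) by (simp add: restr_def[of F z x] compose_def)
  qed
qed

text \<open>The restrictions make the record extensional, as \<open>is_functor\<close> demands, so
  that \<open>P\<close> and \<open>\<rho>\<close> may be arbitrary outside the poset.\<close>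

definition mk_presheaf :: "'a set \<Rightarrow> 'a rel \<Rightarrow> ('a \<Rightarrow> 'u set) \<Rightarrow> ('a \<Rightarrow> 'a \<Rightarrow> 'u \<Rightarrow> 'u)
    \<Rightarrow> ('a, 'u) presheaf" where
  "mk_presheaf A r P \<rho> =
    \<lparr>on_ob = restrict P A, on_ar = (\<lambda>(x, y)\<in>r. (P y, restrict (\<rho> y x) (P y), P x))\<rparr>"

lemma
  shows mk_presheaf_ob: "x \<in> A \<Longrightarrow> on_ob (mk_presheaf A r P \<rho>) x = P x"
    and mk_presheaf_restr: "(x, y) \<in> r \<Longrightarrow> s \<in> P y \<Longrightarrow> restr (mk_presheaf A r P \<rho>) y x s = \<rho> y x s"
  by (auto simp: mk_presheaf_def restr_def)

lemma is_presheaf_mk_presheaf: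
  assumes po: "partial_order_on A r"
    and P: "\<And>x. x \<in> A \<Longrightarrow> P x \<in> \<U>"
    and \<rho>: "\<And>x y s. (x, y) \<in> r \<Longrightarrow> s \<in> P y \<Longrightarrow> \<rho> y x s \<in> P x"
    and \<rho>_id: "\<And>x s. x \<in> A \<Longrightarrow> s \<in> P x \<Longrightarrow> \<rho> x x s = s"
    and \<rho>_comp: "\<And>x y z s. (x, y) \<in> r \<Longrightarrow> (y, z) \<in> r \<Longrightarrow> s \<in> P z \<Longrightarrow> \<rho> y x (\<rho> z y s) = \<rho> z x s"
  shows "is_presheaf \<U> A r (mk_presheaf A r P \<rho>)"
proof -
  have "category (op_cat (poset_cat A r))"
    by (simp add: category_op_cat category_poset_cat po)
  then show ?thesis
    unfolding is_functor_def
  proof (intro conjI ballI impI)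
    show "on_ob (mk_presheaf A r P \<rho>) \<in> Ob (op_cat (poset_cat A r)) \<rightarrow>\<^sub>E Ob (set_cat \<U>)"
      using P by (simp add: mk_presheaf_def op_cat_def poset_cat_def set_cat_def)
    show "on_ar (mk_presheaf A r P \<rho>) \<in> Ar (op_cat (poset_cat A r)) \<rightarrow>\<^sub>E Ar (set_cat \<U>)"
      using P \<rho> partial_order_on_mem[OF po]
      by (auto simp: mk_presheaf_def op_cat_def poset_cat_def set_cat_def)
  next
    fix f assume "f \<in> Ar (op_cat (poset_cat A r))"
    then show "Dom (set_cat \<U>) (on_ar (mk_presheaf A r P \<rho>) f) =
        on_ob (mk_presheaf A r P \<rho>) (Dom (op_cat (poset_cat A r)) f)"
      "Cod (set_cat \<U>) (on_ar (mk_presheaf A r P \<rho>) f) =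
        on_ob (mk_presheaf A r P \<rho>) (Cod (op_cat (poset_cat A r)) f)"
      using partial_order_on_mem[OF po]
      by (cases f; auto simp: mk_presheaf_def op_cat_def poset_cat_def set_cat_def)+
  next
    fix x assume "x \<in> Ob (op_cat (poset_cat A r))"
    then show "on_ar (mk_presheaf A r P \<rho>) (Ident (op_cat (poset_cat A r)) x) =
        Ident (set_cat \<U>) (on_ob (mk_presheaf A r P \<rho>) x)"
      using partial_order_on_refl[OF po] \<rho>_id
      by (auto simp: mk_presheaf_def op_cat_def poset_cat_def set_cat_def intro!: restrict_ext)
  next
    fix f g assume "f \<in> Ar (op_cat (poset_cat A r))" "g \<in> Ar (op_cat (poset_cat A r))"
      "Cod (op_cat (poset_cat A r)) f = Dom (op_cat (poset_cat A r)) g"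
    then obtain x y z where xyz: "f = (y, z)" "g = (x, y)" "(x, y) \<in> r" "(y, z) \<in> r"
      by (cases f; cases g) (auto simp: op_cat_def poset_cat_def)
    moreover have "(x, z) \<in> r"
      using xyz(3,4) by (rule partial_order_on_trans[OF po])
    moreover have "restrict (\<rho> z x) (P z) = compose (P z) (restrict (\<rho> y x) (P y)) (restrict (\<rho> z y) (P z))"
      using xyz by (auto simp: compose_def \<rho> \<rho>_comp intro!: restrict_ext)
    ultimately show "on_ar (mk_presheaf A r P \<rho>) (Comp (op_cat (poset_cat A r)) g f) =
        Comp (set_cat \<U>) (on_ar (mk_presheaf A r P \<rho>) g) (on_ar (mk_presheaf A r P \<rho>) f)"
      by (simp add: mk_presheaf_def op_cat_def poset_cat_def set_cat_def)
  qed (simp_all add: category_set_cat)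
qed

lemma
  assumes "presheaf_hom \<U> A r F G \<eta>" "partial_order_on A r"
  shows presheaf_hom_eq: "x \<in> A \<Longrightarrow> \<eta> x = (on_ob F x, component \<eta> x, on_ob G x)"
    and component_PiE: "x \<in> A \<Longrightarrow> component \<eta> x \<in> on_ob F x \<rightarrow>\<^sub>E on_ob G x"
    and component_mem: "x \<in> A \<Longrightarrow> s \<in> on_ob F x \<Longrightarrow> component \<eta> x s \<in> on_ob G x"
    and component_restr: "(x, y) \<in> r \<Longrightarrow> s \<in> on_ob F y \<Longrightarrow>
      component \<eta> x (restr F y x s) = restr G y x (component \<eta> y s)"
proof -
  have F: "is_presheaf \<U> A r F" and G: "is_presheaf \<U> A r G"
    using assms(1) by (auto simp: nat_trans_def)
  have ar: "\<eta> x = (on_ob F x, component \<eta> x, on_ob G x) \<and>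
      component \<eta> x \<in> on_ob F x \<rightarrow>\<^sub>E on_ob G x" if "x \<in> A" for x
  proof -
    have "\<eta> x \<in> Ar (set_cat \<U>)" "Dom (set_cat \<U>) (\<eta> x) = on_ob F x"
      "Cod (set_cat \<U>) (\<eta> x) = on_ob G x"
      using assms(1) that by (auto simp: nat_trans_def op_cat_def poset_cat_def)
    then show ?thesis
      using set_cat_arrow_eq[of "\<eta> x" \<U>] by (simp add: component_def)
  qed
  show "x \<in> A \<Longrightarrow> \<eta> x = (on_ob F x, component \<eta> x, on_ob G x)"
    using ar[of x] by blast
  show "x \<in> A \<Longrightarrow> component \<eta> x \<in> on_ob F x \<rightarrow>\<^sub>E on_ob G x"
    using ar[of x] by blast
  show "x \<in> A \<Longrightarrow> s \<in> on_ob F x \<Longrightarrow> component \<eta> x s \<in> on_ob G x"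
    using ar[of x] by (blast dest: PiE_mem)
  show "component \<eta> x (restr F y x s) = restr G y x (component \<eta> y s)"
    if r: "(x, y) \<in> r" and s: "s \<in> on_ob F y"
  proof -
    have xy: "x \<in> A" "y \<in> A"
      using partial_order_on_mem[OF assms(2) r] by auto
    have "Comp (set_cat \<U>) (\<eta> x) (on_ar F (x, y)) = Comp (set_cat \<U>) (on_ar G (x, y)) (\<eta> y)"
    proof -
      have "\<forall>f\<in>Ar (op_cat (poset_cat A r)).
          Comp (set_cat \<U>) (\<eta> (Cod (op_cat (poset_cat A r)) f)) (on_ar F f) =
          Comp (set_cat \<U>) (on_ar G f) (\<eta> (Dom (op_cat (poset_cat A r)) f))"
        using assms(1) by (simp add: nat_trans_def)
      then show ?thesis
        using r by (auto simp: op_cat_def poset_cat_def dest: bspec[where x = "(x, y)"])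
    qed
    then have "compose (on_ob F y) (component \<eta> x) (restr F y x) =
        compose (on_ob F y) (restr G y x) (component \<eta> y)"
      unfolding presheaf_ar[OF F assms(2) r] presheaf_ar[OF G assms(2) r]
      using ar[OF xy(1)] ar[OF xy(2)] by (simp add: set_cat_def)
    then show ?thesis
      using s by (auto simp: compose_def dest: fun_cong[where x = s])
  qed
qed

lemma presheaf_homI:
  assumes po: "partial_order_on A r" and F: "is_presheaf \<U> A r F" and G: "is_presheaf \<U> A r G"
    and h: "\<And>x s. x \<in> A \<Longrightarrow> s \<in> on_ob F x \<Longrightarrow> h x s \<in> on_ob G x"
    and nat: "\<And>x y s. (x, y) \<in> r \<Longrightarrow> s \<in> on_ob F y \<Longrightarrow> h x (restr F y x s) = restr G y x (h y s)"
  shows "presheaf_hom \<U> A r F G (\<lambda>x\<in>A. (on_ob F x, restrict (h x) (on_ob F x), on_ob G x))"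
proof -
  have "Comp (set_cat \<U>) (on_ob F x, restrict (h x) (on_ob F x), on_ob G x) (on_ar F (x, y)) =
      Comp (set_cat \<U>) (on_ar G (x, y)) (on_ob F y, restrict (h y) (on_ob F y), on_ob G y)"
    if r: "(x, y) \<in> r" for x y
    unfolding presheaf_ar[OF F po r] presheaf_ar[OF G po r]
    using restr_mem[OF F po r] nat[OF r]
    by (auto simp: set_cat_def compose_def intro!: restrict_ext)
  then show ?thesis
    using F G h presheaf_ob[OF F po] presheaf_ob[OF G po] partial_order_on_mem[OF po]
    unfolding nat_trans_def by (auto simp: op_cat_def poset_cat_def set_cat_def)
qed

text \<open>Testing on elements suffices because the family of components and every underlying map
  are extensional, while sources and targets are fixed by \<open>F\<close> and
  \<open>G\<close>.\<close>

lemma presheaf_hom_eqI: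
  assumes po: "partial_order_on A r"
    and "presheaf_hom \<U> A r F G \<eta>" "presheaf_hom \<U> A r F G \<theta>"
    and "\<And>x s. x \<in> A \<Longrightarrow> s \<in> on_ob F x \<Longrightarrow> component \<eta> x s = component \<theta> x s"
  shows "\<eta> = \<theta>"
proof
  fix x
  show "\<eta> x = \<theta> x"
  proof (cases "x \<in> A")
    case True
    then have "component \<eta> x = component \<theta> x"
      using assms(4) component_PiE[OF assms(2) po True] component_PiE[OF assms(3) po True]
      by (blast intro: PiE_ext)
    then show ?thesis
      using presheaf_hom_eq[OF assms(2) po True] presheaf_hom_eq[OF assms(3) po True] by simp
  next
    case False
    then show ?thesis
      using assms(2,3) by (auto simp: nat_trans_def op_cat_def poset_cat_def PiE_iff extensional_def)
  qed
qed

lemma is_iso_presheaf_hom: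
  assumes po: "partial_order_on A r" and \<eta>: "presheaf_hom \<U> A r F G \<eta>"
    and bij: "\<And>x. x \<in> A \<Longrightarrow> bij_betw (component \<eta> x) (on_ob F x) (on_ob G x)"
  shows "is_iso (functor_cat (op_cat (poset_cat A r)) (set_cat \<U>)) (F, \<eta>, G)"
proof (rule is_iso_functor_cat[OF \<eta>])
  fix x assume "x \<in> Ob (op_cat (poset_cat A r))"
  then have x: "x \<in> A"
    by (simp add: op_cat_def poset_cat_def)
  have F: "is_presheaf \<U> A r F" and G: "is_presheaf \<U> A r G"
    using \<eta> by (auto simp: nat_trans_def)
  show "is_iso (set_cat \<U>) (\<eta> x)"
    unfolding presheaf_hom_eq[OF \<eta> po x]
    using presheaf_ob[OF F po x] presheaf_ob[OF G po x] component_PiE[OF \<eta> po x] bij[OF x]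
    by (rule is_iso_set_cat)
qed

section \<open>Finite products inside the universe\<close>

text \<open>Induction on \<open>I\<close>: the empty product is a singleton, found inside a nonempty
  member of \<open>\<U>\<close>, and each further factor is absorbed by \<open>Times_closed\<close>.
  Equipollence is the right conclusion since elements of the product are functions, not elements of
  members of \<open>\<U>\<close>.\<close>

lemma PiE_eqpoll_in_universe:
  assumes "set_universe \<U>" "finite I" "\<And>i. i \<in> I \<Longrightarrow> P i \<in> \<U>"
  shows "\<exists>Z\<in>\<U>. Z \<approx> Pi\<^sub>E I P"
  using assms(2,3)
proof (induction I)
  case empty
  obtain X a where X: "X \<in> \<U>" "a \<in> X"
    using set_universe.ex_nonempty[OF assms(1)] by blast
  then have "{a} \<in> \<U>"
    by (intro set_universe.subset_closed[OF assms(1) X(1)]) simp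
  then show ?case
    by (intro bexI[of _ "{a}"]) (simp_all add: singleton_eqpoll)
next
  case (insert i I)
  then obtain Z where Z: "Z \<in> \<U>" "Z \<approx> Pi\<^sub>E I P"
    by auto
  obtain W where W: "W \<in> \<U>" "W \<approx> P i \<times> Z"
    using set_universe.Times_closed[OF assms(1) insert.prems[of i] Z(1)] by auto
  have "inj_on (\<lambda>(y, g). g(i := y)) (P i \<times> Pi\<^sub>E I P)"
    using insert.hyps(2) by (rule inj_combinator)
  then have "P i \<times> Pi\<^sub>E I P \<approx> Pi\<^sub>E (insert i I) P"
    unfolding PiE_insert_eq by (rule inj_on_image_eqpoll_self[THEN eqpoll_sym])
  then have "W \<approx> Pi\<^sub>E (insert i I) P"
    by (rule eqpoll_trans[OF W(2) eqpoll_trans[OF times_eqpoll_cong[OF eqpoll_refl Z(2)]]])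
  then show ?case
    using W(1) by blast
qed

section \<open>Sheaves on the space of a poset\<close>

locale poset_on =
  fixes A :: "'a set" and r :: "'a rel"
  assumes po: "partial_order_on A r"
begin

abbreviation "T \<equiv> poset_space A r"
abbreviation "Opens \<equiv> {U. openin T U}"
abbreviation "R \<equiv> opens_rel T"
abbreviation "D \<equiv> down_set A r"

lemma R_po: "partial_order_on Opens R"
  by (rule partial_order_on_opens_rel)

lemma down_refl: "x \<in> A \<Longrightarrow> x \<in> D x"
  by (simp add: down_set_def partial_order_on_refl[OF po])

lemma mem_down_iff: "x \<in> D y \<longleftrightarrow> (x, y) \<in> r"
  using partial_order_on_mem[OF po] by (auto simp: down_set_def)

lemma down_mono: "(x, y) \<in> r \<Longrightarrow> D x \<subseteq> D y"
  using partial_order_on_trans[OF po] by (auto simp: mem_down_iff)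

text \<open>Down-closed sets contain the generators and are stable under the operations generating a
  topology; conversely a down-closed \<open>U\<close> is the union of the sets \<open>D x\<close>
  with \<open>x\<close> in \<open>U\<close>.\<close>

lemma openin_iff: "openin T U \<longleftrightarrow> U \<subseteq> A \<and> (\<forall>x y. (x, y) \<in> r \<longrightarrow> y \<in> U \<longrightarrow> x \<in> U)"
proof
  assume "openin T U"
  then have "generate_topology_on (D ` A) U"
    by (simp add: poset_space_def openin_topology_generated_by_iff)
  then show "U \<subseteq> A \<and> (\<forall>x y. (x, y) \<in> r \<longrightarrow> y \<in> U \<longrightarrow> x \<in> U)"
  proof induction
    case (Basis s)
    then show ?case
      using partial_order_on_mem[OF po]
      by (auto simp: mem_down_iff intro: partial_order_on_trans[OF po])
  qed blast+
next
  assume U: "U \<subseteq> A \<and> (\<forall>x y. (x, y) \<in> r \<longrightarrow> y \<in> U \<longrightarrow> x \<in> U)"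
  then have "U = \<Union>(D ` U)"
    using partial_order_on_refl[OF po] by (fastforce simp: mem_down_iff)
  moreover have "openin T (\<Union>(D ` U))"
    using U by (intro openin_Union) (auto simp: poset_space_def intro!: topology_generated_by_Basis)
  ultimately show "openin T U"
    by simp
qed

lemma openin_down: "x \<in> A \<Longrightarrow> openin T (D x)"
  by (auto simp: poset_space_def intro!: topology_generated_by_Basis)

lemma down_subset: "openin T U \<Longrightarrow> x \<in> U \<Longrightarrow> D x \<subseteq> U"
  by (auto simp: openin_iff mem_down_iff)

lemma open_mem: "openin T U \<Longrightarrow> x \<in> U \<Longrightarrow> x \<in> A"
  by (auto simp: openin_iff)

lemma open_lower: "openin T U \<Longrightarrow> x \<in> U \<Longrightarrow> (y, x) \<in> r \<Longrightarrow> y \<in> U"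
  by (auto simp: openin_iff)

lemma R_iff: "(V, U) \<in> R \<longleftrightarrow> openin T V \<and> openin T U \<and> V \<subseteq> U"
  by (simp add: opens_rel_def)

lemma R_down: "openin T U \<Longrightarrow> x \<in> U \<Longrightarrow> (D x, U) \<in> R"
  using down_subset openin_down[OF open_mem] by (simp add: R_iff)

lemma R_down_down: "(x, y) \<in> r \<Longrightarrow> (D x, D y) \<in> R"
  using down_mono openin_down partial_order_on_mem[OF po] by (simp add: R_iff)

lemma Union_down: "openin T U \<Longrightarrow> \<Union>(D ` U) = U"
  using down_subset down_refl[OF open_mem] by blast

text \<open>Antisymmetry at work. A sheaf glues families indexed by open sets, so a family indexed
  by points must be reindexed by the sets \<open>D x\<close>, and this needs \<open>x\<close> to be
  recoverable from \<open>D x\<close>.\<close>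

lemma inj_on_down: "inj_on D A"
proof (rule inj_onI)
  fix x y assume "x \<in> A" "y \<in> A" "D x = D y"
  then have "(x, y) \<in> r" "(y, x) \<in> r"
    using down_refl[of x] down_refl[of y] by (auto simp: mem_down_iff[symmetric])
  then show "x = y"
    using po by (auto simp: partial_order_on_def dest: antisymD)
qed

section \<open>Separatedness and gluing along the basic open sets\<close>

text \<open>Both \<open>t\<close> and \<open>t'\<close> glue the restrictions of \<open>t\<close> to
  the cover of \<open>U\<close> by the sets \<open>D x\<close>. For empty \<open>U\<close> this
  cover is empty, and the sheaf condition for it makes the sections over \<open>U\<close>
  equal.\<close>

lemma sheaf_separated:
  assumes F: "is_presheaf \<U> Opens R F" and sh: "is_sheaf T F" and U: "openin T U"
    and t: "t \<in> on_ob F U" "t' \<in> on_ob F U"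
    and eq: "\<And>x. x \<in> U \<Longrightarrow> restr F U (D x) t = restr F U (D x) t'"
  shows "t = t'"
proof -
  let ?s = "\<lambda>V. restr F U V t"
  have "\<exists>!u. u \<in> on_ob F (\<Union>(D ` U)) \<and> (\<forall>V\<in>D ` U. restr F (\<Union>(D ` U)) V u = ?s V)"
  proof (rule sh[unfolded is_sheaf_def, rule_format], intro conjI ballI)
    fix V assume V: "V \<in> D ` U"
    then have VU: "(V, U) \<in> R"
      using R_down[OF U] by auto
    then show "openin T V" "?s V \<in> on_ob F V"
      using restr_mem[OF F R_po VU t(1)] by (auto simp: R_iff)
    fix W assume W: "W \<in> D ` U"
    then have "(W, U) \<in> R"
      using R_down[OF U] by auto
    with VU have "(V \<inter> W, V) \<in> R" "(V \<inter> W, W) \<in> R" "(W, U) \<in> R"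
      by (auto simp: R_iff)
    with VU t(1) show "restr F V (V \<inter> W) (?s V) = restr F W (V \<inter> W) (?s W)"
      by (simp add: restr_restr[OF F R_po])
  qed
  moreover have "\<forall>V\<in>D ` U. restr F U V t' = ?s V"
    using eq by auto
  ultimately show ?thesis
    unfolding Union_down[OF U] using t by blast
qed

text \<open>Compatibility is given along the order only, while the sheaf condition asks for
  agreement on \<open>D x \<inter> D y\<close>, which need not be a basic set. Agreement there is
  itself tested on each \<open>D z\<close> contained in it, where both sides restrict to
  \<open>s z\<close>; hence separatedness has to come first.\<close>

lemma sheaf_glue:
  assumes F: "is_presheaf \<U> Opens R F" and sh: "is_sheaf T F" and U: "openin T U"
    and s: "\<And>x. x \<in> U \<Longrightarrow> s x \<in> on_ob F (D x)"
    and comp: "\<And>x y. (x, y) \<in> r \<Longrightarrow> y \<in> U \<Longrightarrow> restr F (D y) (D x) (s y) = s x"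
  obtains t where "t \<in> on_ob F U" "\<And>x. x \<in> U \<Longrightarrow> restr F U (D x) t = s x"
proof -
  let ?i = "the_inv_into A D"
  have i: "?i (D x) = x" if "x \<in> A" for x
    using inj_on_down that by (rule the_inv_into_f_f)
  have "\<exists>!u. u \<in> on_ob F (\<Union>(D ` U)) \<and> (\<forall>V\<in>D ` U. restr F (\<Union>(D ` U)) V u = s (?i V))"
  proof (rule sh[unfolded is_sheaf_def, rule_format], intro conjI ballI)
    fix V assume "V \<in> D ` U"
    then obtain x where x: "x \<in> U" "V = D x" "x \<in> A"
      using open_mem[OF U] by auto
    then show "openin T V" "s (?i V) \<in> on_ob F V"
      using s openin_down by (auto simp: i)
    fix W assume "W \<in> D ` U"
    then obtain y where y: "y \<in> U" "W = D y" "y \<in> A"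
      using open_mem[OF U] by auto
    have VW: "(V \<inter> W, V) \<in> R" "(V \<inter> W, W) \<in> R" "openin T (V \<inter> W)"
      using x y openin_down by (auto simp: R_iff)
    have "restr F V (V \<inter> W) (s x) = restr F W (V \<inter> W) (s y)"
    proof (rule sheaf_separated[OF F sh VW(3)])
      show "restr F V (V \<inter> W) (s x) \<in> on_ob F (V \<inter> W)"
        "restr F W (V \<inter> W) (s y) \<in> on_ob F (V \<inter> W)"
        using VW x y s by (auto intro: restr_mem[OF F R_po])
      fix z assume z: "z \<in> V \<inter> W"
      then have "(z, x) \<in> r" "(z, y) \<in> r"
        using x y by (auto simp: mem_down_iff)
      then show "restr F (V \<inter> W) (D z) (restr F V (V \<inter> W) (s x)) =
          restr F (V \<inter> W) (D z) (restr F W (V \<inter> W) (s y))"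
        using R_down[OF VW(3) z] VW x y s comp by (simp add: restr_restr[OF F R_po])
    qed
    then show "restr F V (V \<inter> W) (s (?i V)) = restr F W (V \<inter> W) (s (?i W))"
      using x y by (simp add: i)
  qed
  then obtain t where "t \<in> on_ob F U" "\<forall>x\<in>U. restr F U (D x) t = s (?i (D x))"
    unfolding Union_down[OF U] by auto
  then show thesis
    using that open_mem[OF U] by (simp add: i)
qed

section \<open>Restriction of sheaves to the basis\<close>

definition basis_inclusion :: "('a, 'a \<times> 'a, 'a set, 'a set \<times> 'a set) cat_functor" where
  "basis_inclusion = \<lparr>on_ob = (\<lambda>x\<in>A. D x), on_ar = (\<lambda>(x, y)\<in>r. (D x, D y))\<rparr>"

abbreviation "poset_op \<equiv> op_cat (poset_cat A r)"
abbreviation "opens_op \<equiv> op_cat (poset_cat Opens R)"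

lemma category_poset_op: "category poset_op"
  by (simp add: category_op_cat category_poset_cat po)

lemma category_opens_op: "category opens_op"
  by (intro category_op_cat category_poset_cat R_po)

lemma is_functor_basis_inclusion: "is_functor poset_op opens_op basis_inclusion"
  unfolding is_functor_def
proof (intro conjI ballI impI category_poset_op category_opens_op)
  show "on_ob basis_inclusion \<in> Ob poset_op \<rightarrow>\<^sub>E Ob opens_op"
    by (simp add: basis_inclusion_def op_cat_def poset_cat_def openin_down)
  show "on_ar basis_inclusion \<in> Ar poset_op \<rightarrow>\<^sub>E Ar opens_op"
    using R_down_down by (auto simp: basis_inclusion_def op_cat_def poset_cat_def)
next
  fix f assume "f \<in> Ar poset_op"
  then show "Dom opens_op (on_ar basis_inclusion f) = on_ob basis_inclusion (Dom poset_op f)"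
    "Cod opens_op (on_ar basis_inclusion f) = on_ob basis_inclusion (Cod poset_op f)"
    using partial_order_on_mem[OF po]
    by (cases f; simp add: basis_inclusion_def op_cat_def poset_cat_def)+
next
  fix x assume "x \<in> Ob poset_op"
  then show "on_ar basis_inclusion (Ident poset_op x) = Ident opens_op (on_ob basis_inclusion x)"
    using partial_order_on_refl[OF po] by (simp add: basis_inclusion_def op_cat_def poset_cat_def)
next
  fix f g assume fg: "f \<in> Ar poset_op" "g \<in> Ar poset_op" "Cod poset_op f = Dom poset_op g"
  obtain x y z where "f = (y, z)" "g = (x, y)" "(x, y) \<in> r" "(y, z) \<in> r"
    using fg by (cases f; cases g) (auto simp: op_cat_def poset_cat_def)
  then show "on_ar basis_inclusion (Comp poset_op g f) =
      Comp opens_op (on_ar basis_inclusion g) (on_ar basis_inclusion f)"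
    using partial_order_on_trans[OF po, of x y z]
    by (simp add: basis_inclusion_def op_cat_def poset_cat_def)
qed

definition on_basis :: "('a set, 'u) presheaf \<Rightarrow> ('a, 'u) presheaf" where
  "on_basis F = comp_functor poset_op F basis_inclusion"

lemma on_basis_ob: "x \<in> A \<Longrightarrow> on_ob (on_basis F) x = on_ob F (D x)"
  by (simp add: on_basis_def comp_functor_def op_cat_def poset_cat_def basis_inclusion_def)

lemma on_basis_restr: "(x, y) \<in> r \<Longrightarrow> restr (on_basis F) y x = restr F (D y) (D x)"
  by (simp add: on_basis_def restr_def[abs_def] comp_functor_def op_cat_def poset_cat_def
      basis_inclusion_def)

lemma is_presheaf_on_basis: "is_presheaf \<U> Opens R F \<Longrightarrow> is_presheaf \<U> A r (on_basis F)"
  unfolding on_basis_def by (rule is_functor_comp_functor[OF is_functor_basis_inclusion])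

lemma presheaf_hom_on_basis:
  assumes "presheaf_hom \<U> Opens R F G \<eta>"
  shows "presheaf_hom \<U> A r (on_basis F) (on_basis G) (\<lambda>x\<in>A. \<eta> (D x))"
proof -
  have "(\<lambda>x\<in>Ob poset_op. \<eta> (on_ob basis_inclusion x)) = (\<lambda>x\<in>A. \<eta> (D x))"
    by (auto simp: op_cat_def poset_cat_def basis_inclusion_def)
  then show ?thesis
    using nat_trans_precomp[OF is_functor_basis_inclusion assms] by (simp add: on_basis_def)
qed

text \<open>Here \<open>id_functor\<close> serves as the inclusion of sheaves into all presheaves on
  the open sets. Written as a composite of two general functors, restriction inherits functoriality
  from them.\<close>

definition restriction_functor ::
  "'u set set \<Rightarrow>
    (('a set, 'u) presheaf,
     ('a set, 'u) presheaf \<times> ('a set \<Rightarrow> 'u set \<times> ('u \<Rightarrow> 'u) \<times> 'u set) \<times> ('a set, 'u) presheaf,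
     ('a, 'u) presheaf,
     ('a, 'u) presheaf \<times> ('a \<Rightarrow> 'u set \<times> ('u \<Rightarrow> 'u) \<times> 'u set) \<times> ('a, 'u) presheaf) cat_functor"
  where "restriction_functor \<U> = comp_functor (space_topos \<U> T)
    (precomp_functor poset_op opens_op (set_cat \<U>) basis_inclusion) (id_functor (space_topos \<U> T))"

lemma space_topos_Ob_iff:
  "F \<in> Ob (space_topos \<U> T) \<longleftrightarrow> is_presheaf \<U> Opens R F \<and> is_sheaf T F"
  by (simp add: space_topos_def full_subcat_def functor_cat_def)

lemma space_topos_hom_iff:
  assumes "F \<in> Ob (space_topos \<U> T)" "G \<in> Ob (space_topos \<U> T)"
  shows "f \<in> hom_set (space_topos \<U> T) F G \<longleftrightarrow> (\<exists>\<eta>. f = (F, \<eta>, G) \<and> presheaf_hom \<U> Opens R F G \<eta>)"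
  using assms by (auto simp: space_topos_def full_subcat_def functor_cat_def hom_set_def)

lemma poset_topos_hom_iff:
  "f \<in> hom_set (poset_topos \<U> A r) P Q \<longleftrightarrow> (\<exists>\<eta>. f = (P, \<eta>, Q) \<and> presheaf_hom \<U> A r P Q \<eta>)"
  by (auto simp: poset_topos_def functor_cat_def hom_set_def)

lemma is_functor_restriction_functor:
  "is_functor (space_topos \<U> T) (poset_topos \<U> A r) (restriction_functor \<U>)"
proof -
  have "is_functor (space_topos \<U> T) (functor_cat opens_op (set_cat \<U>)) (id_functor (space_topos \<U> T))"
    unfolding space_topos_def
    by (intro is_functor_full_subcat_inclusion category_functor_cat category_opens_op category_set_cat)
  then show ?thesis
    unfolding restriction_functor_def poset_topos_def
    by (rule is_functor_comp_functor)
      (intro is_functor_precomp_functor is_functor_basis_inclusion category_set_cat)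
qed

lemma restriction_functor_ob:
  "F \<in> Ob (space_topos \<U> T) \<Longrightarrow> on_ob (restriction_functor \<U>) F = on_basis F"
  by (simp add: restriction_functor_def comp_functor_def id_functor_def precomp_functor_def
      on_basis_def space_topos_Ob_iff functor_cat_def)

lemma restriction_functor_ar:
  assumes "F \<in> Ob (space_topos \<U> T)" "G \<in> Ob (space_topos \<U> T)" "presheaf_hom \<U> Opens R F G \<eta>"
  shows "on_ar (restriction_functor \<U>) (F, \<eta>, G) = (on_basis F, \<lambda>x\<in>A. \<eta> (D x), on_basis G)"
proof -
  have "(F, \<eta>, G) \<in> Ar (space_topos \<U> T)" "(F, \<eta>, G) \<in> Ar (functor_cat opens_op (set_cat \<U>))"
    using assms space_topos_hom_iff[OF assms(1,2)] by (auto simp: functor_cat_def hom_set_def)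
  then show ?thesis
    by (auto simp: restriction_functor_def comp_functor_def id_functor_def precomp_functor_def
      on_basis_def op_cat_def poset_cat_def basis_inclusion_def intro!: restrict_ext)
qed

section \<open>Full faithfulness of restriction\<close>

text \<open>Fullness. The image of a section \<open>s\<close> over \<open>V\<close> is glued in
  \<open>G\<close> from the images under \<open>\<theta>\<close> of the restrictions of
  \<open>s\<close> to the sets \<open>D x\<close>; naturality of the result follows from
  separatedness of \<open>G\<close>.\<close>

lemma presheaf_hom_extends_from_basis:
  assumes F: "is_presheaf \<U> Opens R F"
    and G: "is_presheaf \<U> Opens R G" "is_sheaf T G"
    and \<theta>: "presheaf_hom \<U> A r (on_basis F) (on_basis G) \<theta>"
  obtains \<eta> where "presheaf_hom \<U> Opens R F G \<eta>" "(\<lambda>x\<in>A. \<eta> (D x)) = \<theta>"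
proof -
  have "\<exists>t. t \<in> on_ob G V \<and> (\<forall>x\<in>V. restr G V (D x) t = component \<theta> x (restr F V (D x) s))"
    if V: "openin T V" and s: "s \<in> on_ob F V" for V s
  proof -
    have *: "restr F V (D x) s \<in> on_ob (on_basis F) x" if "x \<in> V" for x
      using restr_mem[OF F R_po R_down[OF V that] s] open_mem[OF V that] by (simp add: on_basis_ob)
    obtain t where "t \<in> on_ob G V"
      "\<And>x. x \<in> V \<Longrightarrow> restr G V (D x) t = component \<theta> x (restr F V (D x) s)"
    proof (rule sheaf_glue[OF G V])
      show "component \<theta> x (restr F V (D x) s) \<in> on_ob G (D x)" if "x \<in> V" for x
        using component_mem[OF \<theta> po open_mem[OF V that] *[OF that]] open_mem[OF V that]
        by (simp add: on_basis_ob)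
      \<comment> \<open>Compatibility of the pieces is naturality of \<open>\<theta>\<close> along
        \<open>(x, y)\<close>.\<close>
      show "restr G (D y) (D x) (component \<theta> y (restr F V (D y) s)) =
          component \<theta> x (restr F V (D x) s)" if r: "(x, y) \<in> r" and y: "y \<in> V" for x y
        using component_restr[OF \<theta> po r *[OF y]] R_down[OF V y] R_down_down[OF r]
        by (simp add: on_basis_restr[OF r] restr_restr[OF F R_po _ _ s])
    qed (use that in blast)
    then show ?thesis by blast
  qed
  then obtain h where h: "\<And>V s. openin T V \<Longrightarrow> s \<in> on_ob F V \<Longrightarrow> h V s \<in> on_ob G V"
    and h_restr: "\<And>V s x. openin T V \<Longrightarrow> s \<in> on_ob F V \<Longrightarrow> x \<in> V \<Longrightarrow>
      restr G V (D x) (h V s) = component \<theta> x (restr F V (D x) s)"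
    by metis
  define \<eta> where "\<eta> = (\<lambda>V\<in>Opens. (on_ob F V, restrict (h V) (on_ob F V), on_ob G V))"
  have \<eta>: "presheaf_hom \<U> Opens R F G \<eta>"
    unfolding \<eta>_def
  proof (rule presheaf_homI[OF R_po F G(1)])
    fix V W s assume VW: "(V, W) \<in> R" and s: "s \<in> on_ob F W"
    then have V: "openin T V" and W: "openin T W" and sub: "V \<subseteq> W"
      by (auto simp: R_iff)
    note sV = restr_mem[OF F R_po VW s]
    show "h V (restr F W V s) = restr G W V (h W s)"
    proof (rule sheaf_separated[OF G V])
      show "h V (restr F W V s) \<in> on_ob G V" "restr G W V (h W s) \<in> on_ob G V"
        using h[OF V sV] restr_mem[OF G(1) R_po VW h[OF W s]] by auto
      fix x assume x: "x \<in> V"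
      then have xW: "x \<in> W"
        using sub by blast
      show "restr G V (D x) (h V (restr F W V s)) = restr G V (D x) (restr G W V (h W s))"
        by (simp add: h_restr[OF V sV x] restr_restr[OF F R_po R_down[OF V x] VW s]
            restr_restr[OF G(1) R_po R_down[OF V x] VW h[OF W s]] h_restr[OF W s xW])
    qed
  qed (use h in auto)
  have "(\<lambda>x\<in>A. \<eta> (D x)) = \<theta>"
  proof (rule presheaf_hom_eqI[OF po presheaf_hom_on_basis[OF \<eta>] \<theta>])
    fix x s assume x: "x \<in> A" and "s \<in> on_ob (on_basis F) x"
    then have s: "s \<in> on_ob F (D x)"
      by (simp add: on_basis_ob)
    have "h (D x) s = component \<theta> x s"
    \<comment> \<open>The glued section \<open>h (D x) s\<close> is known only through its
      restrictions, so it is compared with \<open>\<theta>\<close> on every \<open>D y\<close>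
      below, where equality is naturality of \<open>\<theta>\<close>.\<close>
    proof (rule sheaf_separated[OF G openin_down[OF x]])
      show "h (D x) s \<in> on_ob G (D x)"
        by (rule h[OF openin_down[OF x] s])
      show "component \<theta> x s \<in> on_ob G (D x)"
        using component_mem[OF \<theta> po x] s x by (simp add: on_basis_ob)
      fix y assume y: "y \<in> D x"
      then have r: "(y, x) \<in> r"
        by (simp add: mem_down_iff)
      show "restr G (D x) (D y) (h (D x) s) = restr G (D x) (D y) (component \<theta> x s)"
        using component_restr[OF \<theta> po r] s x
        by (simp add: h_restr[OF openin_down[OF x] s y] on_basis_ob on_basis_restr[OF r])
    qed
    then show "component (\<lambda>x\<in>A. \<eta> (D x)) x s = component \<theta> x s"
      using x s openin_down[OF x] by (simp add: component_def \<eta>_def)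
  qed
  with \<eta> show thesis by (rule that)
qed

text \<open>Faithfulness: a section of \<open>G\<close> is determined by its restrictions to basic
  sets, and naturality moves both transformations there, where they agree.\<close>

lemma presheaf_hom_eq_on_basis:
  assumes F: "is_presheaf \<U> Opens R F"
    and G: "is_presheaf \<U> Opens R G" "is_sheaf T G"
    and \<eta>: "presheaf_hom \<U> Opens R F G \<eta>" and \<eta>': "presheaf_hom \<U> Opens R F G \<eta>'"
    and eq: "(\<lambda>x\<in>A. \<eta> (D x)) = (\<lambda>x\<in>A. \<eta>' (D x))"
  shows "\<eta> = \<eta>'"
proof (rule presheaf_hom_eqI[OF R_po \<eta> \<eta>'])
  fix V s assume "V \<in> Opens" and s: "s \<in> on_ob F V"
  then have V: "openin T V"
    by simp
  show "component \<eta> V s = component \<eta>' V s"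
  proof (rule sheaf_separated[OF G V])
    show "component \<eta> V s \<in> on_ob G V" "component \<eta>' V s \<in> on_ob G V"
      using component_mem[OF \<eta> R_po] component_mem[OF \<eta>' R_po] V s by auto
    fix x assume x: "x \<in> V"
    then have "\<eta> (D x) = \<eta>' (D x)"
      using fun_cong[OF eq, of x] open_mem[OF V x] by simp
    then have "component \<eta> (D x) = component \<eta>' (D x)"
      by (simp add: component_def[abs_def])
    then show "restr G V (D x) (component \<eta> V s) = restr G V (D x) (component \<eta>' V s)"
      using component_restr[OF \<eta> R_po R_down[OF V x] s] component_restr[OF \<eta>' R_po R_down[OF V x] s]
      by simp
  qed
qed

lemma fully_faithful_restriction_functor:
  "fully_faithful (space_topos \<U> T) (poset_topos \<U> A r) (restriction_functor \<U>)"
  unfolding fully_faithful_def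
proof (intro ballI)
  fix F G g assume F: "F \<in> Ob (space_topos \<U> T)" and G: "G \<in> Ob (space_topos \<U> T)"
    and g: "g \<in> hom_set (poset_topos \<U> A r) (on_ob (restriction_functor \<U>) F)
      (on_ob (restriction_functor \<U>) G)"
  obtain \<theta> where \<theta>: "g = (on_basis F, \<theta>, on_basis G)"
    "presheaf_hom \<U> A r (on_basis F) (on_basis G) \<theta>"
    using g by (auto simp: restriction_functor_ob[OF F] restriction_functor_ob[OF G] poset_topos_hom_iff)
  have F': "is_presheaf \<U> Opens R F" and G': "is_presheaf \<U> Opens R G" "is_sheaf T G"
    using F G by (auto simp: space_topos_Ob_iff)
  obtain \<eta> where \<eta>: "presheaf_hom \<U> Opens R F G \<eta>" "(\<lambda>x\<in>A. \<eta> (D x)) = \<theta>"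
    using presheaf_hom_extends_from_basis[OF F' G' \<theta>(2)] .
  show "\<exists>!f. f \<in> hom_set (space_topos \<U> T) F G \<and> on_ar (restriction_functor \<U>) f = g"
  proof (rule ex1I[of _ "(F, \<eta>, G)"])
    show "(F, \<eta>, G) \<in> hom_set (space_topos \<U> T) F G \<and>
        on_ar (restriction_functor \<U>) (F, \<eta>, G) = g"
      using \<eta> \<theta> by (simp add: space_topos_hom_iff[OF F G] restriction_functor_ar[OF F G])
    fix f assume f: "f \<in> hom_set (space_topos \<U> T) F G \<and> on_ar (restriction_functor \<U>) f = g"
    then obtain \<eta>' where \<eta>': "f = (F, \<eta>', G)" "presheaf_hom \<U> Opens R F G \<eta>'"
      by (auto simp: space_topos_hom_iff[OF F G])
    then have "(\<lambda>x\<in>A. \<eta>' (D x)) = \<theta>"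
      using f \<theta>(1) by (simp add: restriction_functor_ar[OF F G])
    then show "f = (F, \<eta>, G)"
      using presheaf_hom_eq_on_basis[OF F' G' \<eta>'(2) \<eta>(1)] \<eta>(2) \<eta>'(1) by simp
  qed
qed

section \<open>Extending a presheaf by compatible families\<close>

text \<open>A concrete model of the limit of \<open>P\<close> over \<open>U\<close>. The clause
  mentions only \<open>y \<in> U\<close>; for open \<open>U\<close> this forces
  \<open>x \<in> U\<close>. Since families are extensional, restricting one to a smaller open set is
  just \<open>restrict\<close>.\<close>

definition families :: "('a, 'u) presheaf \<Rightarrow> 'a set \<Rightarrow> ('a \<Rightarrow> 'u) set" where
  "families P U = {s \<in> \<Pi>\<^sub>E x\<in>U. on_ob P x. \<forall>x y. (x, y) \<in> r \<longrightarrow> y \<in> U \<longrightarrow> restr P y x (s y) = s x}"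

lemma families_restrict:
  assumes "s \<in> families P U" "openin T V" "V \<subseteq> U"
  shows "restrict s V \<in> families P V"
  using assms open_lower[OF assms(2)] by (auto simp: families_def)

text \<open>\<open>x\<close> is the greatest element of \<open>D x\<close>, so the value at
  \<open>x\<close> determines the whole family, and the inverse spreads \<open>p\<close> downwards
  by restriction. This is why the extension restricts back to \<open>P\<close> on the basis.\<close>

lemma families_bij_eval:
  assumes P: "is_presheaf \<U> A r P" and x: "x \<in> A"
  shows "bij_betw (\<lambda>s. s x) (families P (D x)) (on_ob P x)"
proof (rule bij_betw_byWitness[where f' = "\<lambda>p. \<lambda>y\<in>D x. restr P x y p"])
  show "\<forall>s\<in>families P (D x). (\<lambda>y\<in>D x. restr P x y (s x)) = s"
  proof
    fix s assume "s \<in> families P (D x)"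
    then have "restr P x y (s x) = s y" if "y \<in> D x" for y
      using that down_refl[OF x] by (auto simp: families_def mem_down_iff)
    moreover have "s \<in> extensional (D x)"
      using \<open>s \<in> families P (D x)\<close> by (auto simp: families_def PiE_def)
    ultimately show "(\<lambda>y\<in>D x. restr P x y (s x)) = s"
      by (auto simp: extensional_def)
  qed
  show "\<forall>p\<in>on_ob P x. (\<lambda>y\<in>D x. restr P x y p) x = p"
    using down_refl[OF x] restr_id[OF P po x] by simp
  show "(\<lambda>s. s x) ` families P (D x) \<subseteq> on_ob P x"
    using down_refl[OF x] by (auto simp: families_def)
  show "(\<lambda>p. \<lambda>y\<in>D x. restr P x y p) ` on_ob P x \<subseteq> families P (D x)"
  proof (rule image_subsetI)
    fix p assume p: "p \<in> on_ob P x"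
    have "restr P z y (restr P x z p) = restr P x y p" if "(y, z) \<in> r" "z \<in> D x" for y z
      using restr_restr[OF P po that(1) _ p] that(2) by (simp add: mem_down_iff)
    moreover have "y \<in> D x" if "(y, z) \<in> r" "z \<in> D x" for y z
      using partial_order_on_trans[OF po] that by (auto simp: mem_down_iff)
    moreover have "restr P x y p \<in> on_ob P y" if "y \<in> D x" for y
      using restr_mem[OF P po _ p] that by (simp add: mem_down_iff)
    ultimately show "(\<lambda>y\<in>D x. restr P x y p) \<in> families P (D x)"
      by (simp add: families_def)
  qed
qed

text \<open>Families are functions and glue pointwise. If \<open>(x, y) \<in> r\<close> and
  \<open>y\<close> lies in a member \<open>U\<close> of the cover, then so does \<open>x\<close>,
  because \<open>U\<close> is open; compatibility of the glued family is therefore checked inside a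
  single member.\<close>

lemma families_glue:
  assumes \<C>: "\<And>U. U \<in> \<C> \<Longrightarrow> openin T U" and s: "\<And>U. U \<in> \<C> \<Longrightarrow> s U \<in> families P U"
    and comp: "\<And>U V. U \<in> \<C> \<Longrightarrow> V \<in> \<C> \<Longrightarrow> restrict (s U) (U \<inter> V) = restrict (s V) (U \<inter> V)"
  shows "\<exists>!t. t \<in> families P (\<Union>\<C>) \<and> (\<forall>U\<in>\<C>. restrict t U = s U)"
proof (rule ex_ex1I)
  \<comment> \<open>Which member containing \<open>x\<close> is chosen does not matter, by
    \<open>comp\<close>; the next fact records this and hides the choice.\<close>
  define t where "t = (\<lambda>x\<in>\<Union>\<C>. s (SOME U. U \<in> \<C> \<and> x \<in> U) x)"
  have t: "t x = s U x" if "U \<in> \<C>" "x \<in> U" for U x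
  proof -
    let ?V = "SOME U. U \<in> \<C> \<and> x \<in> U"
    have "?V \<in> \<C> \<and> x \<in> ?V"
      using that by (intro someI[of "\<lambda>U. U \<in> \<C> \<and> x \<in> U" U]) simp
    then have "s ?V x = s U x"
      using fun_cong[OF comp[OF that(1), of ?V], of x] that by simp
    then show ?thesis
      using that by (auto simp: t_def)
  qed
  have "t \<in> families P (\<Union>\<C>)"
    unfolding families_def
  proof (intro CollectI conjI allI impI)
    show "t \<in> (\<Pi>\<^sub>E x\<in>\<Union>\<C>. on_ob P x)"
    proof (rule PiE_I)
      fix x assume "x \<in> \<Union>\<C>"
      then obtain U where U: "U \<in> \<C>" "x \<in> U" by blast
      then show "t x \<in> on_ob P x"
        using s[OF U(1)] by (auto simp: t[OF U] families_def)
    qed (simp add: t_def)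
    fix x y assume r: "(x, y) \<in> r" and "y \<in> \<Union>\<C>"
    then obtain U where U: "U \<in> \<C>" "y \<in> U" by blast
    then show "restr P y x (t y) = t x"
      using s[OF U(1)] r open_lower[OF \<C>[OF U(1)] U(2) r] by (auto simp: t[OF U(1)] families_def)
  qed
  moreover have "restrict t U = s U" if "U \<in> \<C>" for U
  proof (rule PiE_ext)
    show "s U \<in> (\<Pi>\<^sub>E x\<in>U. on_ob P x)" "restrict t U \<in> (\<Pi>\<^sub>E x\<in>U. on_ob P x)"
      using s[OF that] t[OF that] by (auto simp: families_def)
  qed (simp add: t[OF that])
  ultimately show "\<exists>t. t \<in> families P (\<Union>\<C>) \<and> (\<forall>U\<in>\<C>. restrict t U = s U)"
    by blast
next
  fix t t' assume t: "t \<in> families P (\<Union>\<C>) \<and> (\<forall>U\<in>\<C>. restrict t U = s U)"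
    and t': "t' \<in> families P (\<Union>\<C>) \<and> (\<forall>U\<in>\<C>. restrict t' U = s U)"
  show "t = t'"
  proof (rule PiE_ext)
    show "t \<in> (\<Pi>\<^sub>E x\<in>\<Union>\<C>. on_ob P x)" "t' \<in> (\<Pi>\<^sub>E x\<in>\<Union>\<C>. on_ob P x)"
      using t t' by (auto simp: families_def)
    fix x assume "x \<in> \<Union>\<C>"
    then obtain U where "U \<in> \<C>" "x \<in> U" by blast
    then show "t x = t' x"
      using t t' by (metis restrict_apply')
  qed
qed

text \<open>Sections over \<open>U\<close> must be elements of the small set \<open>Z U\<close>, so the families are transported along an
  arbitrary bijection \<open>b U\<close> from \<open>Z U\<close> to \<open>families P U\<close>.\<close>

lemma ex_sheaf_extending:
  assumes fin: "finite A" and \<U>: "set_universe \<U>" and P: "is_presheaf \<U> A r P"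
  obtains F \<epsilon> where "is_presheaf \<U> Opens R F" "is_sheaf T F"
    "presheaf_hom \<U> A r (on_basis F) P \<epsilon>"
    "\<And>x. x \<in> A \<Longrightarrow> bij_betw (component \<epsilon> x) (on_ob (on_basis F) x) (on_ob P x)"
proof -
  have "\<exists>Z b. Z \<in> \<U> \<and> bij_betw b Z (families P U)" if U: "openin T U" for U
  proof -
    have "finite U" "\<And>x. x \<in> U \<Longrightarrow> on_ob P x \<in> \<U>"
      using fin U presheaf_ob[OF P po] by (auto simp: openin_iff intro: finite_subset)
    then obtain Z b where Z: "Z \<in> \<U>" and b: "bij_betw b Z (\<Pi>\<^sub>E x\<in>U. on_ob P x)"
      using PiE_eqpoll_in_universe[OF \<U>, of U "on_ob P"] by (auto simp: eqpoll_def)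
    let ?Z = "{z \<in> Z. b z \<in> families P U}"
    have "bij_betw b ?Z (families P U)"
      using b by (auto simp: bij_betw_def inj_on_def families_def image_iff)
    moreover have "?Z \<in> \<U>"
      by (rule set_universe.subset_closed[OF \<U> Z]) blast
    ultimately show ?thesis by blast
  qed
  then obtain Z b where Z: "\<And>U. openin T U \<Longrightarrow> Z U \<in> \<U>"
    and b: "\<And>U. openin T U \<Longrightarrow> bij_betw (b U) (Z U) (families P U)"
    by metis
  define c where "c U = inv_into (Z U) (b U)" for U
  have b_mem: "b U z \<in> families P U" if "openin T U" "z \<in> Z U" for U z
    using bij_betwE[OF b[OF that(1)]] that(2) by blast
  have c_mem: "c U s \<in> Z U" if "openin T U" "s \<in> families P U" for U s
    using bij_betwE[OF bij_betw_inv_into[OF b[OF that(1)]]] that(2) by (simp add: c_def)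
  have bc: "b U (c U s) = s" if "openin T U" "s \<in> families P U" for U s
    using bij_betw_inv_into_right[OF b[OF that(1)] that(2)] by (simp add: c_def)
  have cb: "c U (b U z) = z" if "openin T U" "z \<in> Z U" for U z
    using bij_betw_inv_into_left[OF b[OF that(1)] that(2)] by (simp add: c_def)
  have b_inj: "z = z'" if "openin T U" "z \<in> Z U" "z' \<in> Z U" "b U z = b U z'" for U z z'
    using cb[OF that(1,2)] cb[OF that(1,3)] that(4) by metis
  \<comment> \<open>Elements of \<open>Z U\<close> are codes for families: decode, restrict, encode
    again. By \<open>b_\<rho>\<close> decoding turns \<open>\<rho>\<close> into plain restriction of
    functions, to which the presheaf and sheaf laws reduce.\<close>
  define \<rho> where "\<rho> U V z = c V (restrict (b U z) V)" for U V z
  have \<rho>_fam: "restrict (b U z) V \<in> families P V" if "(V, U) \<in> R" "z \<in> Z U" for U V z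
    using that by (auto simp: R_iff intro: families_restrict[OF b_mem])
  have \<rho>_mem: "\<rho> U V z \<in> Z V" if "(V, U) \<in> R" "z \<in> Z U" for U V z
    using c_mem[OF _ \<rho>_fam[OF that]] that(1) by (simp add: \<rho>_def R_iff)
  have b_\<rho>: "b V (\<rho> U V z) = restrict (b U z) V" if "(V, U) \<in> R" "z \<in> Z U" for U V z
    using bc[OF _ \<rho>_fam[OF that]] that(1) by (simp add: \<rho>_def R_iff)
  define F where "F = mk_presheaf Opens R Z \<rho>"
  have F_ob: "on_ob F U = Z U" if "openin T U" for U
    using that by (simp add: F_def mk_presheaf_ob)
  have F_restr: "restr F U V z = \<rho> U V z" if "(V, U) \<in> R" "z \<in> Z U" for U V z
    using that by (simp add: F_def mk_presheaf_restr)
  have F: "is_presheaf \<U> Opens R F"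
    unfolding F_def
  proof (rule is_presheaf_mk_presheaf[OF R_po])
    show "\<rho> U U z = z" if "U \<in> Opens" "z \<in> Z U" for U z
    proof -
      have "restrict (b U z) U = b U z"
        using b_mem[of U z] that by (auto simp: families_def PiE_def extensional_restrict)
      then show ?thesis
        using that by (simp add: \<rho>_def cb)
    qed
    show "\<rho> V W (\<rho> U V z) = \<rho> U W z" if "(W, V) \<in> R" "(V, U) \<in> R" "z \<in> Z U" for U V W z
    proof -
      have "V \<inter> W = W"
        using that(1) by (auto simp: R_iff)
      then show ?thesis
        unfolding \<rho>_def[of V W] \<rho>_def[of U W] b_\<rho>[OF that(2,3)] by simp
    qed
  qed (use Z \<rho>_mem in auto)
  have sh: "is_sheaf T F"
    unfolding is_sheaf_def
  proof (intro allI impI, elim conjE)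
    fix \<C> s assume \<C>: "\<forall>U\<in>\<C>. openin T U" and s: "\<forall>U\<in>\<C>. s U \<in> on_ob F U"
      and comp: "\<forall>U\<in>\<C>. \<forall>V\<in>\<C>. restr F U (U \<inter> V) (s U) = restr F V (U \<inter> V) (s V)"
    let ?W = "\<Union>\<C>"
    have W: "openin T ?W"
      using \<C> by (intro openin_Union) blast
    have s': "s U \<in> Z U" "(U, ?W) \<in> R" if "U \<in> \<C>" for U
      using s \<C> W that by (auto simp: F_ob R_iff)
    have fam: "\<exists>!t. t \<in> families P ?W \<and> (\<forall>U\<in>\<C>. restrict t U = b U (s U))"
    proof (rule families_glue)
      fix U V assume UV: "U \<in> \<C>" "V \<in> \<C>"
      then have R: "(U \<inter> V, U) \<in> R" "(U \<inter> V, V) \<in> R"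
        using \<C> by (auto simp: R_iff)
      have "restr F U (U \<inter> V) (s U) = restr F V (U \<inter> V) (s V)"
        using comp UV by blast
      then have "\<rho> U (U \<inter> V) (s U) = \<rho> V (U \<inter> V) (s V)"
        by (simp add: F_restr[OF R(1) s'(1)[OF UV(1)]] F_restr[OF R(2) s'(1)[OF UV(2)]])
      then show "restrict (b U (s U)) (U \<inter> V) = restrict (b V (s V)) (U \<inter> V)"
        using b_\<rho>[OF R(1) s'(1)[OF UV(1)]] b_\<rho>[OF R(2) s'(1)[OF UV(2)]] by simp
    qed (use \<C> s' b_mem in auto)
    \<comment> \<open>Decoding is injective, so a code solves the gluing problem in \<open>F\<close>
      exactly when its family solves the decoded one; existence and uniqueness then transfer from
      \<open>fam\<close>.\<close>
    have iff: "(\<forall>U\<in>\<C>. restr F ?W U t = s U) \<longleftrightarrow> (\<forall>U\<in>\<C>. restrict (b ?W t) U = b U (s U))"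
      if t: "t \<in> Z ?W" for t
    proof (intro ball_cong refl)
      fix U assume U: "U \<in> \<C>"
      show "restr F ?W U t = s U \<longleftrightarrow> restrict (b ?W t) U = b U (s U)"
        using b_inj[OF _ \<rho>_mem[OF s'(2)[OF U] t] s'(1)[OF U]] \<C> U
        by (auto simp: F_restr[OF s'(2)[OF U] t] b_\<rho>[OF s'(2)[OF U] t, symmetric])
    qed
    obtain f where f: "f \<in> families P ?W" "\<forall>U\<in>\<C>. restrict f U = b U (s U)"
      using fam by blast
    show "\<exists>!t. t \<in> on_ob F ?W \<and> (\<forall>U\<in>\<C>. restr F ?W U t = s U)"
      unfolding F_ob[OF W]
    proof (rule ex1I[of _ "c ?W f"])
      show "c ?W f \<in> Z ?W \<and> (\<forall>U\<in>\<C>. restr F ?W U (c ?W f) = s U)"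
        using c_mem[OF W f(1)] f(2) iff by (simp add: bc[OF W f(1)])
      fix t assume t: "t \<in> Z ?W \<and> (\<forall>U\<in>\<C>. restr F ?W U t = s U)"
      then have "b ?W t = f"
        using fam f b_mem[OF W, of t] iff[of t] by blast
      then show "t = c ?W f"
        using cb[OF W, of t] t by simp
    qed
  qed
  \<comment> \<open>Decode a section over \<open>D x\<close> and evaluate the family at the greatest
    element of \<open>D x\<close>.\<close>
  define h where "h x z = b (D x) z x" for x z
  define \<epsilon> where
    "\<epsilon> = (\<lambda>x\<in>A. (on_ob (on_basis F) x, restrict (h x) (on_ob (on_basis F) x), on_ob P x))"
  have basis_ob: "on_ob (on_basis F) x = Z (D x)" if "x \<in> A" for x
    using that by (simp add: on_basis_ob F_ob openin_down)
  have h_bij: "bij_betw (h x) (on_ob (on_basis F) x) (on_ob P x)" if x: "x \<in> A" for x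
    using bij_betw_trans[OF b[OF openin_down[OF x]] families_bij_eval[OF P x]]
    unfolding basis_ob[OF x] by (simp add: h_def[abs_def] comp_def)
  have \<epsilon>: "presheaf_hom \<U> A r (on_basis F) P \<epsilon>"
    unfolding \<epsilon>_def
  proof (rule presheaf_homI[OF po is_presheaf_on_basis[OF F] P])
    show "h x z \<in> on_ob P x" if "x \<in> A" "z \<in> on_ob (on_basis F) x" for x z
      using bij_betwE[OF h_bij[OF that(1)]] that(2) by blast
    fix x y z assume r: "(x, y) \<in> r" and "z \<in> on_ob (on_basis F) y"
    moreover have xy: "x \<in> A" "y \<in> A"
      using partial_order_on_mem[OF po r] by auto
    ultimately have z: "z \<in> Z (D y)"
      by (simp add: basis_ob)
    have "h x (restr (on_basis F) y x z) = restrict (b (D y) z) (D x) x"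
      by (simp add: h_def on_basis_restr[OF r] F_restr[OF R_down_down[OF r] z]
          b_\<rho>[OF R_down_down[OF r] z])
    also have "\<dots> = b (D y) z x"
      using down_refl[OF xy(1)] by simp
    \<comment> \<open>Compatibility of the decoded family along \<open>(x, y)\<close>, with
      \<open>y\<close> the greatest element of \<open>D y\<close>: naturality of evaluation is built
      into \<open>families\<close>.\<close>
    also have "\<dots> = restr P y x (h y z)"
      using b_mem[OF openin_down[OF xy(2)] z] r down_refl[OF xy(2)] by (simp add: h_def families_def)
    finally show "h x (restr (on_basis F) y x z) = restr P y x (h y z)" .
  qed
  show thesis
  proof (rule that[OF F sh \<epsilon>])
    fix x assume x: "x \<in> A"
    have "component \<epsilon> x z = h x z" if "z \<in> on_ob (on_basis F) x" for z
      using x that by (simp add: component_def \<epsilon>_def)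
    then show "bij_betw (component \<epsilon> x) (on_ob (on_basis F) x) (on_ob P x)"
      using h_bij[OF x] by (simp cong: bij_betw_cong)
  qed
qed

lemma essentially_surjective_restriction_functor:
  assumes "finite A" "set_universe \<U>"
  shows "essentially_surjective (space_topos \<U> T) (poset_topos \<U> A r) (restriction_functor \<U>)"
  unfolding essentially_surjective_def
proof
  fix P assume "P \<in> Ob (poset_topos \<U> A r)"
  then have P: "is_presheaf \<U> A r P"
    by (simp add: poset_topos_def functor_cat_def)
  obtain F \<epsilon> where F: "is_presheaf \<U> Opens R F" "is_sheaf T F"
    and \<epsilon>: "presheaf_hom \<U> A r (on_basis F) P \<epsilon>"
      "\<And>x. x \<in> A \<Longrightarrow> bij_betw (component \<epsilon> x) (on_ob (on_basis F) x) (on_ob P x)"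
    using ex_sheaf_extending[OF assms P] by metis
  have Ob: "F \<in> Ob (space_topos \<U> T)"
    using F by (simp add: space_topos_Ob_iff)
  show "\<exists>F\<in>Ob (space_topos \<U> T). \<exists>e\<in>hom_set (poset_topos \<U> A r) (on_ob (restriction_functor \<U>) F) P.
      is_iso (poset_topos \<U> A r) e"
  proof (intro bexI[OF _ Ob] bexI)
    show "is_iso (poset_topos \<U> A r) (on_basis F, \<epsilon>, P)"
      unfolding poset_topos_def by (rule is_iso_presheaf_hom[OF po \<epsilon>])
    show "(on_basis F, \<epsilon>, P) \<in> hom_set (poset_topos \<U> A r) (on_ob (restriction_functor \<U>) F) P"
      using \<epsilon>(1) by (simp add: restriction_functor_ob[OF Ob] poset_topos_hom_iff)
  qed
qed

end

theorem proposition12: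
  fixes A :: "'a set" and r :: "'a rel" and \<U> :: "'u set set"
  assumes "finite A" and "partial_order_on A r"
    and "set_universe \<U>"
  shows "equivalent_categories (poset_topos \<U> A r) (space_topos \<U> (poset_space A r))"
proof -
  interpret poset_on A r
    by unfold_locales (fact assms(2))
  show ?thesis
    \<comment> \<open>Restriction runs from sheaves to presheaves, opposite to the order in the
      statement, hence the symmetry.\<close>
    by (rule equivalent_categories_sym[OF equivalent_categoriesI[OF is_functor_restriction_functor
          fully_faithful_restriction_functor essentially_surjective_restriction_functor[OF assms(1,3)]]])
qed

end
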